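(* There is an algorithm which, given any matrix $A\in\mathbb{R}^{n\times n}$, any vector $b\in\mathbb{R}^n$ and any finite set of delays $D\subset\mathbb{N}$, decides in finite time whether the linear system with switched delays $(A,b,D)$ is controllable with arbitrarily large look-ahead.
   Context: Linear system with switched delays $(A,b,D)$ (single input): $x(t+1)=Ax(t)+b\sum_{0\le t'\le t:\ t'+\sigma(t')=t}v(t')$, with $\sigma:\mathbb{N}\to D$ an arbitrary switching signal and $v(t)\in\mathbb{R}$ the controller output. Controllable with arbitrarily large look-ahead: the controller may use knowledge of the whole signal $\sigma$, and for every $x_0$, $x_f$ and $\sigma$ there is a control signal $v$ and a $t\ge0$ such that $x(0)=x_0$ implies $x(t)=x_f$. Equivalently, the system is uncontrollable iff there is a switching signal $\sigma$ such that for all $t\in\mathbb{N}$ the vectors $\{A^{t-t'-\sigma(t')}b:\ t'\ge0,\ t-t'-\sigma(t')\ge0\}$ do not span $\mathbb{R}^n$. The algorithm operates with exact arithmetic on the entries of $A$ and $b$. *)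

theory Defs
  imports "Jordan_Normal_Form.Matrix"
begin

section \<open>Linear systems with switched delays\<close>

primrec trajectory ::
  "real mat \<Rightarrow> real vec \<Rightarrow> (nat \<Rightarrow> nat) \<Rightarrow> (nat \<Rightarrow> real) \<Rightarrow> real vec \<Rightarrow> nat \<Rightarrow> real vec" where
  "trajectory A b \<sigma> v x0 0 = x0"
| "trajectory A b \<sigma> v x0 (Suc t) =
     A *\<^sub>v trajectory A b \<sigma> v x0 t + (\<Sum>t' | t' \<le> t \<and> t' + \<sigma> t' = t. v t') \<cdot>\<^sub>v b"

text \<open>The control signal is chosen after the whole switching signal, which is what
  arbitrarily large look-ahead means.\<close>

definition controllable :: "real mat \<Rightarrow> real vec \<Rightarrow> nat set \<Rightarrow> bool" where
  "controllable A b D \<longleftrightarrow>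
     (\<forall>\<sigma>. range \<sigma> \<subseteq> D \<longrightarrow>
       (\<forall>x0 \<in> carrier_vec (dim_vec b). \<forall>xf \<in> carrier_vec (dim_vec b).
          \<exists>v t. trajectory A b \<sigma> v x0 t = xf))"


section \<open>Algorithms with exact real arithmetic\<close>

text \<open>
  Algorithms are programs of a real random access machine. It has one memory for natural
  numbers and one for real numbers, both addressed by natural numbers computed at run time.
  Real numbers are manipulated only by exact field operations and order comparisons. The only
  built-in real constants are 0 and 1: arbitrary real constants could encode an
  uncomputable oracle. There is no rounding operation, so information passes from the real
  memory to the natural number memory only through comparisons.
\<close>

type_synonym state = "(nat \<Rightarrow> nat) \<times> (nat \<Rightarrow> real)"

datatype nexp =
    NConst nat
  | NCell nexp
  | NAdd nexp nexp
  | NSub nexp nexp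
  | NMult nexp nexp
  | NDiv nexp nexp
  | NMod nexp nexp

datatype rexp =
    RZero
  | ROne
  | RCell nexp
  | RAdd rexp rexp
  | RSub rexp rexp
  | RMult rexp rexp
  | RDiv rexp rexp

datatype bexp =
    NLess nexp nexp
  | RLess rexp rexp
  | BNot bexp
  | BAnd bexp bexp

datatype prog =
    Skip
  | NStore nexp nexp
  | RStore nexp rexp
  | Seq prog prog
  | Cond bexp prog prog
  | While bexp prog

primrec nval :: "nexp \<Rightarrow> state \<Rightarrow> nat" where
  "nval (NConst k) s = k"
| "nval (NCell a) s = fst s (nval a s)"
| "nval (NAdd a c) s = nval a s + nval c s"
| "nval (NSub a c) s = nval a s - nval c s"
| "nval (NMult a c) s = nval a s * nval c s"
| "nval (NDiv a c) s = nval a s div nval c s"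
| "nval (NMod a c) s = nval a s mod nval c s"

text \<open>Division is total: dividing by zero yields zero. A program can always test the
  divisor first, so this convention adds no power.\<close>

primrec rval :: "rexp \<Rightarrow> state \<Rightarrow> real" where
  "rval RZero s = 0"
| "rval ROne s = 1"
| "rval (RCell a) s = snd s (nval a s)"
| "rval (RAdd x y) s = rval x s + rval y s"
| "rval (RSub x y) s = rval x s - rval y s"
| "rval (RMult x y) s = rval x s * rval y s"
| "rval (RDiv x y) s = rval x s / rval y s"

primrec bval :: "bexp \<Rightarrow> state \<Rightarrow> bool" where
  "bval (NLess a c) s \<longleftrightarrow> nval a s < nval c s"
| "bval (RLess x y) s \<longleftrightarrow> rval x s < rval y s"
| "bval (BNot p) s \<longleftrightarrow> \<not> bval p s"
| "bval (BAnd p q) s \<longleftrightarrow> bval p s \<and> bval q s"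

text \<open>\<open>exec P s s'\<close>: started in \<open>s\<close>, the program \<open>P\<close> halts after finitely many steps in \<open>s'\<close>.\<close>

inductive exec :: "prog \<Rightarrow> state \<Rightarrow> state \<Rightarrow> bool" where
  Skip: "exec Skip s s"
| NStore: "exec (NStore a e) s ((fst s)(nval a s := nval e s), snd s)"
| RStore: "exec (RStore a x) s (fst s, (snd s)(nval a s := rval x s))"
| Seq: "exec P s s' \<Longrightarrow> exec Q s' s'' \<Longrightarrow> exec (Seq P Q) s s''"
| CondTrue: "bval c s \<Longrightarrow> exec P s s' \<Longrightarrow> exec (Cond c P Q) s s'"
| CondFalse: "\<not> bval c s \<Longrightarrow> exec Q s s' \<Longrightarrow> exec (Cond c P Q) s s'"
| WhileFalse: "\<not> bval c s \<Longrightarrow> exec (While c P) s s"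
| WhileTrue: "bval c s \<Longrightarrow> exec P s s' \<Longrightarrow> exec (While c P) s' s'' \<Longrightarrow> exec (While c P) s s''"

inductive_cases SkipE: "exec Skip s t"
inductive_cases NStoreE: "exec (NStore a e) s t"
inductive_cases RStoreE: "exec (RStore a x) s t"
inductive_cases SeqE: "exec (Seq P Q) s t"
inductive_cases CondE: "exec (Cond c P Q) s t"
inductive_cases WhileE: "exec (While c P) s t"

lemma exec_deterministic: "exec P s t \<Longrightarrow> exec P s u \<Longrightarrow> t = u"
proof (induction arbitrary: u rule: exec.induct)
  case Skip then show ?case by (rule SkipE) simp
next
  case NStore then show ?case by (rule NStoreE) simp
next
  case RStore then show ?case by (rule RStoreE) simp
next
  case Seq then show ?case by (metis SeqE)
next
  case CondTrue then show ?case by (metis CondE)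
next
  case CondFalse then show ?case by (metis CondE)
next
  case WhileFalse then show ?case by (metis WhileE)
next
  case WhileTrue then show ?case by (metis WhileE)
qed

text \<open>
  Input: the natural number memory holds the dimension, the number of delays and the delays
  in increasing order; the real memory holds the entries of \<open>A\<close> row by row, followed by the
  entries of \<open>b\<close>. All other cells are zero.
\<close>

definition input_state :: "nat \<Rightarrow> real mat \<Rightarrow> real vec \<Rightarrow> nat set \<Rightarrow> state" where
  "input_state n A b D =
    (\<lambda>k. if k = 0 then n
         else if k = 1 then card D
         else if k < card D + 2 then sorted_list_of_set D ! (k - 2)
         else 0,
     \<lambda>k. if k < n * n then A $$ (k div n, k mod n)
         else if k < n * n + n then b $ (k - n * n)
         else 0)"

text \<open>The program halts on the input and leaves its answer in cell 0 of the natural number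
  memory: 1 for yes, 0 for no.\<close>

definition halts_with_answer :: "prog \<Rightarrow> state \<Rightarrow> bool \<Rightarrow> bool" where
  "halts_with_answer P s ans \<longleftrightarrow> (\<exists>s'. exec P s s' \<and> fst s' 0 = (if ans then 1 else 0))"

end

(* A system is uncontrollable iff some switching signal keeps the delivered inputs from spanning the
   state space at all times; the moment curve avoids countably many proper subspaces. It suffices
   to look at a computable time horizon N. Let a signal be deficient up to time N, witnessed by
   functionals c_T. Either c_T can be chosen nonzero on the invertible part of A at a late time; then,
   read backwards, the orbit A^k b stays in a finite union of hyperplanes, and a long enough
   stay produces a subspace in that union that is invariant under some A^p, hence a periodic
   signal that is deficient forever. Or the c_T vanish on the invertible part from some time on;
   then only the last n delivery times matter, and a repeated window of the signal can be
   continued periodically. The program tries all signals up to N and tests spanning with the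
   orthogonal projection onto the complement of the span, whose trace is its dimension. *)
theory Submission imports Defs "HOL-Analysis.Continuum_Not_Denumerable"
begin


text \<open>The obstacle is that the horizon may depend only on the dimension and the delays:
  nothing about the eigenvalues of A can be used. Hence the argument rests on dimension counts and
  repeated words alone. A stretch of conditions either raises a rank or contains a repetition that
  leaves the solution space unchanged; since the rank is at most n, n + 1 nested pigeonholes
  suffice, and they produce the iterated exponential \<open>grow\<close>. The two parts of A are
  separated because every time needs a nonzero functional. Pulling one functional back along powers
  of A supplies functionals for all times, provided that these powers do not kill it. A functional
  killed within n steps cannot be reused in this way, but it ignores every input delivered at least
  n steps ago. Countability enters because the arrival time may depend on the target, so a single
  target has to be missed at all times at once.\<close>

section \<open>Vectors and matrices as functions on indices\<close>

definition dot :: "nat \<Rightarrow> (nat \<Rightarrow> real) \<Rightarrow> (nat \<Rightarrow> real) \<Rightarrow> real" where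
  "dot n x y = (\<Sum>i<n. x i * y i)"

definition app :: "nat \<Rightarrow> (nat \<Rightarrow> nat \<Rightarrow> real) \<Rightarrow> (nat \<Rightarrow> real) \<Rightarrow> nat \<Rightarrow> real" where
  "app n M x i = (\<Sum>j<n. M i j * x j)"

text \<open>Entries from \<open>n\<close> on carry no meaning, so only the first \<open>n\<close>
  entries are inspected.\<close>

definition nonzero :: "nat \<Rightarrow> (nat \<Rightarrow> real) \<Rightarrow> bool" where
  "nonzero n x \<longleftrightarrow> (\<exists>i<n. x i \<noteq> 0)"

abbreviation (input) tr :: "(nat \<Rightarrow> nat \<Rightarrow> real) \<Rightarrow> nat \<Rightarrow> nat \<Rightarrow> real" where
  "tr M \<equiv> \<lambda>i j. M j i"

lemma dot_commute: "dot n x y = dot n y x"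
  by (simp add: dot_def mult.commute)

lemma dot_cong: "(\<And>i. i < n \<Longrightarrow> x i = x' i) \<Longrightarrow> (\<And>i. i < n \<Longrightarrow> y i = y' i) \<Longrightarrow> dot n x y = dot n x' y'"
  by (simp add: dot_def)

lemma app_cong: "(\<And>j. j < n \<Longrightarrow> x j = y j) \<Longrightarrow> app n M x = app n M y"
  by (simp add: app_def fun_eq_iff)

lemma dot_self_eq_0: "dot n x x = 0 \<longleftrightarrow> \<not> nonzero n x"
  by (auto simp: dot_def nonzero_def sum_nonneg_eq_0_iff)

lemma dot_not_nonzero: "\<not> nonzero n x \<Longrightarrow> dot n x y = 0" "\<not> nonzero n x \<Longrightarrow> dot n y x = 0"
  by (simp_all add: dot_def nonzero_def)

lemma dot_app: "dot n c (app n M x) = dot n (app n (tr M) c) x"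
proof -
  have "dot n c (app n M x) = (\<Sum>i<n. \<Sum>j<n. c i * M i j * x j)"
    by (simp add: dot_def app_def sum_distrib_left mult.assoc)
  also have "\<dots> = (\<Sum>j<n. \<Sum>i<n. c i * M i j * x j)"
    by (rule sum.swap)
  finally show ?thesis
    by (simp add: dot_def app_def sum_distrib_right mult.commute[of "c _"])
qed

lemma dot_app_pow: "dot n c ((app n M ^^ k) x) = dot n ((app n (tr M) ^^ k) c) x"
  by (induction k arbitrary: x) (simp_all add: funpow_swap1 dot_app)

lemma app_add: "app n M (\<lambda>i. x i + y i) = (\<lambda>i. app n M x i + app n M y i)"
  by (simp add: app_def distrib_left sum.distrib fun_eq_iff)

lemma app_sum: "app n M (\<lambda>i. \<Sum>t\<in>S. a t * X t i) = (\<lambda>i. \<Sum>t\<in>S. a t * app n M (X t) i)"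
proof
  fix i
  have "app n M (\<lambda>i. \<Sum>t\<in>S. a t * X t i) i = (\<Sum>j<n. \<Sum>t\<in>S. a t * (M i j * X t j))"
    by (simp add: app_def sum_distrib_left mult.left_commute)
  also have "\<dots> = (\<Sum>t\<in>S. \<Sum>j<n. a t * (M i j * X t j))"
    by (rule sum.swap)
  finally show "app n M (\<lambda>i. \<Sum>t\<in>S. a t * X t i) i = (\<Sum>t\<in>S. a t * app n M (X t) i)"
    by (simp add: app_def sum_distrib_left)
qed

lemma app_pow_sum:
  "(app n M ^^ k) (\<lambda>i. \<Sum>t\<in>S. a t * X t i) = (\<lambda>i. \<Sum>t\<in>S. a t * (app n M ^^ k) (X t) i)"
  by (induction k) (simp_all add: app_sum)

lemma app_pow_cong:
  assumes "\<And>j. j < n \<Longrightarrow> x j = y j" "i < n"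
  shows "(app n M ^^ k) x i = (app n M ^^ k) y i"
  using assms(2) by (induction k arbitrary: i) (simp_all add: assms(1) cong: app_cong)

lemma app_not_nonzero: "\<not> nonzero n x \<Longrightarrow> app n M x = (\<lambda>i. 0)"
  by (auto simp: app_def nonzero_def)

lemma app_pow_not_nonzero: "\<not> nonzero n x \<Longrightarrow> \<not> nonzero n ((app n M ^^ k) x)"
  by (induction k) (simp_all add: app_not_nonzero, simp add: nonzero_def)

section \<open>Projecting onto an orthogonal complement\<close>

text \<open>A Gram-Schmidt step without normalisation: it removes the direction of
  \<open>P x\<close> from the range of \<open>P\<close> using field operations only, without square
  roots.\<close>

definition deflate :: "nat \<Rightarrow> (nat \<Rightarrow> nat \<Rightarrow> real) \<Rightarrow> (nat \<Rightarrow> real) \<Rightarrow> nat \<Rightarrow> nat \<Rightarrow> real" where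
  "deflate n P x i j = P i j - app n P x i * app n P x j / dot n (app n P x) (app n P x)"

text \<open>\<open>proj n X k\<close> is the matrix of the orthogonal projection onto the complement of the span of
  \<open>X 0, \<dots>, X (k - 1)\<close>. A vector that is already in the span changes nothing, since then
  the quotient in \<^const>\<open>deflate\<close> is 0/0 = 0.\<close>

fun proj :: "nat \<Rightarrow> (nat \<Rightarrow> nat \<Rightarrow> real) \<Rightarrow> nat \<Rightarrow> nat \<Rightarrow> nat \<Rightarrow> real" where
  "proj n X 0 = (\<lambda>i j. if i = j then 1 else 0)"
| "proj n X (Suc k) = deflate n (proj n X k) (X k)"

lemma deflate_zero: "deflate n P (\<lambda>_. 0) = P"
  by (simp add: deflate_def app_def fun_eq_iff)

lemma proj_cong: "(\<And>t. t < k \<Longrightarrow> X t = Y t) \<Longrightarrow> proj n X k = proj n Y k"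
  by (induction k) simp_all

lemma proj_sym: "proj n X k i j = proj n X k j i"
  by (induction k) (simp_all add: deflate_def mult.commute)

lemma tr_proj: "tr (proj n X k) = proj n X k"
  by (intro ext) (rule proj_sym)

lemma dot_proj: "dot n c (app n (proj n X k) x) = dot n (app n (proj n X k) c) x"
  by (simp add: dot_app tr_proj)

lemma app_deflate:
  "app n (deflate n P x) y i =
     app n P y i - app n P x i * dot n (app n P x) y / dot n (app n P x) (app n P x)"
  by (simp add: app_def[of n "deflate n P x"] deflate_def dot_def[of n "app n P x" y]
      left_diff_distrib sum_subtractf sum_distrib_left sum_divide_distrib mult.assoc
      flip: app_def)

text \<open>By symmetry the removed direction has the same product with \<open>c\<close> as
  \<open>X k\<close> itself, namely 0.\<close>

lemma proj_fix:
  assumes "\<And>t. t < k \<Longrightarrow> dot n c (X t) = 0" "i < n"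
  shows "app n (proj n X k) c i = c i"
  using assms
proof (induction k arbitrary: i)
  case 0
  have "app n (proj n X 0) c i = (\<Sum>j<n. if i = j then c j else 0)"
    unfolding app_def by (intro sum.cong) auto
  then show ?case using 0 by simp
next
  case (Suc k)
  have "dot n (app n (proj n X k) (X k)) c = dot n (X k) (app n (proj n X k) c)"
    by (simp add: dot_proj)
  also have "\<dots> = dot n (X k) c"
    using Suc by (intro dot_cong) auto
  also have "\<dots> = 0" using Suc.prems(1)[of k] by (simp add: dot_commute)
  finally show ?case using Suc by (simp add: app_deflate)
qed

lemma app_diff_scale: "app n M (\<lambda>i. x i - y i * a / b) = (\<lambda>i. app n M x i - app n M y i * a / b)"
  by (rule ext) (simp add: app_def right_diff_distrib sum_subtractf sum_divide_distrib
      sum_distrib_right mult.assoc)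

lemma dot_diff_scale: "dot n z (\<lambda>i. x i - y i * a / b) = dot n z x - dot n z y * a / b"
  by (simp add: dot_def right_diff_distrib sum_subtractf sum_divide_distrib
      sum_distrib_right mult.assoc)

text \<open>The removed direction \<open>u\<close> is itself fixed by the previous projection, so
  the cross terms cancel; if \<open>u\<close> vanishes, division by \<open>s = 0\<close> gives
  0.\<close>

lemma proj_idem: "app n (proj n X k) (app n (proj n X k) x) = app n (proj n X k) x"
proof (induction k arbitrary: x)
  case 0
  have id: "app n (proj n X 0) y i = (if i < n then y i else 0)" for y i
    by (simp add: app_def if_distrib[of "\<lambda>z. z * _"] cong: if_cong)
  show ?case by (simp add: id fun_eq_iff del: proj.simps)
next
  case (Suc k)
  define P u s where "P = proj n X k" and "u = app n P (X k)" and "s = dot n u u"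
  have def: "app n (proj n X (Suc k)) y = (\<lambda>i. app n P y i - u i * dot n u y / s)" for y
    by (simp add: app_deflate P_def u_def s_def fun_eq_iff)
  have "app n P u = u" by (simp add: u_def P_def Suc.IH)
  moreover have "dot n u (app n P x) = dot n u x"
    using dot_proj[of n u X k x] \<open>app n P u = u\<close> by (simp add: P_def)
  ultimately show ?case
    unfolding def app_diff_scale dot_diff_scale
    by (auto simp: P_def Suc.IH s_def fun_eq_iff)
qed

lemma dot_proj_self:
  "dot n (app n (proj n X k) x) x = dot n (app n (proj n X k) x) (app n (proj n X k) x)"
  by (metis dot_proj proj_idem)

lemma proj_kill:
  assumes "t < k"
  shows "\<not> nonzero n (app n (proj n X k) (X t))"
  using assms
proof (induction k)
  case (Suc k)
  define P u where "P = proj n X k" and "u = app n P (X k)"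
  show ?case
  proof (cases "t = k")
    case True
    have "dot n u (X k) = dot n u u"
      unfolding u_def P_def by (rule dot_proj_self)
    then show ?thesis
      using True dot_self_eq_0[of n u]
      by (auto simp: app_deflate nonzero_def simp flip: P_def u_def)
  next
    case False
    with Suc have z: "\<not> nonzero n (app n P (X t))" by (simp add: P_def)
    have "dot n u (X t) = dot n (X k) (app n P (X t))"
      by (simp add: u_def P_def dot_proj)
    also have "\<dots> = 0" using z by (rule dot_not_nonzero)
    finally show ?thesis using z
      by (auto simp: app_deflate nonzero_def simp flip: P_def u_def)
  qed
qed simp

text \<open>What a projection removes is a combination of the vectors deflated so far. When the
  projection is zero, the coefficients later become the control values.\<close>

lemma proj_span: "\<exists>a. \<forall>i<n. x i - app n (proj n X k) x i = (\<Sum>t<k. a t * X t i)"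
proof (induction k arbitrary: x)
  case 0
  show ?case using proj_fix[of 0 n x X] by simp
next
  case (Suc k)
  define P u where "P = proj n X k" and "u = app n P (X k)"
  define r where "r = dot n u x / dot n u u"
  obtain a where a: "\<And>i. i < n \<Longrightarrow> x i - app n P x i = (\<Sum>t<k. a t * X t i)"
    using Suc.IH[of x] by (auto simp: P_def)
  obtain c where c: "\<And>i. i < n \<Longrightarrow> X k i - u i = (\<Sum>t<k. c t * X t i)"
    using Suc.IH[of "X k"] by (auto simp: P_def u_def)
  show ?case
  proof (intro exI allI impI)
    fix i assume i: "i < n"
    have sum: "(\<Sum>t<k. (a t - r * c t) * X t i) = (x i - app n P x i) - r * (X k i - u i)"
      by (simp add: a[OF i] c[OF i] left_diff_distrib sum_subtractf sum_distrib_left mult.assoc)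
    have "x i - app n (proj n X (Suc k)) x i = x i - app n P x i + r * u i"
      by (simp add: app_deflate r_def flip: P_def u_def)
    also have "\<dots> = (\<Sum>t<k. (a t - r * c t) * X t i) + r * X k i"
      unfolding sum by (simp add: algebra_simps)
    finally show "x i - app n (proj n X (Suc k)) x i =
        (\<Sum>t<Suc k. (if t = k then r else a t - r * c t) * X t i)"
      by simp
  qed
qed

text \<open>Symmetry and idempotence put the squared norms of the rows on the diagonal. Hence the
  trace is nonnegative and vanishes only with the whole matrix.\<close>

lemma proj_diag:
  assumes "i < n"
  shows "proj n X k i i = (\<Sum>j<n. (proj n X k i j)\<^sup>2)"
proof -
  define e :: "nat \<Rightarrow> real" where "e j = (if j = i then 1 else 0)" for j
  have col: "app n (proj n X k) e j = proj n X k j i" for j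
    using assms by (simp add: app_def e_def if_distrib[of "\<lambda>z. _ * z"] cong: if_cong)
  have "proj n X k i i = app n (proj n X k) (app n (proj n X k) e) i"
    by (simp add: proj_idem col)
  also have "\<dots> = (\<Sum>j<n. proj n X k i j * proj n X k j i)"
    unfolding col by (simp add: app_def col)
  also have "\<dots> = (\<Sum>j<n. (proj n X k i j)\<^sup>2)"
    unfolding power2_eq_square by (subst proj_sym[of n X k _ i]) (rule refl)
  finally show ?thesis .
qed

definition trace :: "nat \<Rightarrow> (nat \<Rightarrow> nat \<Rightarrow> real) \<Rightarrow> real" where
  "trace n P = (\<Sum>i<n. P i i)"

lemma trace_proj_nonneg: "trace n (proj n X k) \<ge> 0"
  unfolding trace_def by (rule sum_nonneg) (simp add: proj_diag sum_nonneg)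

lemma trace_proj_eq_0:
  "trace n (proj n X k) = 0 \<longleftrightarrow> (\<forall>i<n. \<forall>j<n. proj n X k i j = 0)"
proof -
  have "trace n (proj n X k) = (\<Sum>i<n. \<Sum>j<n. (proj n X k i j)\<^sup>2)"
    unfolding trace_def by (intro sum.cong) (simp_all add: proj_diag)
  then show ?thesis
    by (auto simp: sum_nonneg_eq_0_iff sum_nonneg)
qed

text \<open>A nonzero column of the projection is orthogonal to all the vectors; conversely a
  functional orthogonal to them is fixed by the projection. Spanning thus becomes one comparison of
  reals.\<close>

lemma trace_proj_pos_iff:
  "0 < trace n (proj n X k) \<longleftrightarrow> (\<exists>c. nonzero n c \<and> (\<forall>t<k. dot n c (X t) = 0))"
proof
  assume "0 < trace n (proj n X k)"
  then obtain i j where ij: "i < n" "j < n" "proj n X k i j \<noteq> 0"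
    using trace_proj_eq_0[of n X k] by auto
  define e :: "nat \<Rightarrow> real" where "e l = (if l = j then 1 else 0)" for l
  have "app n (proj n X k) e i = proj n X k i j"
    using ij by (simp add: app_def e_def if_distrib[of "\<lambda>z. _ * z"] cong: if_cong)
  then have "nonzero n (app n (proj n X k) e)" using ij by (auto simp: nonzero_def)
  moreover have "dot n (app n (proj n X k) e) (X t) = 0" if "t < k" for t
    using proj_kill[OF that, of n X] by (simp add: dot_not_nonzero flip: dot_proj)
  ultimately show "\<exists>c. nonzero n c \<and> (\<forall>t<k. dot n c (X t) = 0)" by blast
next
  assume "\<exists>c. nonzero n c \<and> (\<forall>t<k. dot n c (X t) = 0)"
  then obtain c where c: "nonzero n c" "\<And>t. t < k \<Longrightarrow> dot n c (X t) = 0" by blast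
  then obtain i where "i < n" "app n (proj n X k) c i \<noteq> 0"
    using proj_fix[of k n c X] by (auto simp: nonzero_def)
  then have "\<exists>j<n. proj n X k i j \<noteq> 0"
    by (auto simp: app_def intro: ccontr)
  then have "trace n (proj n X k) \<noteq> 0" using \<open>i < n\<close> by (auto simp: trace_proj_eq_0)
  then show "0 < trace n (proj n X k)" using trace_proj_nonneg[of n X k] by simp
qed

section \<open>Rank, and stabilisation of the kernels of matrix powers\<close>

definition rank :: "nat \<Rightarrow> (nat \<Rightarrow> nat \<Rightarrow> real) \<Rightarrow> nat \<Rightarrow> nat" where
  "rank n X k = card {t. t < k \<and> nonzero n (app n (proj n X t) (X t))}"

lemma rank_Suc:
  "rank n X (Suc k) = rank n X k + (if nonzero n (app n (proj n X k) (X k)) then 1 else 0)"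
proof -
  have "{t. t < Suc k \<and> nonzero n (app n (proj n X t) (X t))} =
      (if nonzero n (app n (proj n X k) (X k)) then insert k else id)
        {t. t < k \<and> nonzero n (app n (proj n X t) (X t))}"
    by (auto simp: less_Suc_eq)
  then show ?thesis by (simp add: rank_def)
qed

lemma rank_0 [simp]: "rank n X 0 = 0"
  by (simp add: rank_def)

text \<open>A new direction \<open>u\<close> lowers the trace by the quotient of its squared norm by
  itself, which is 1, or 0 if \<open>u\<close> vanishes.\<close>

lemma trace_proj: "trace n (proj n X k) = real n - real (rank n X k)"
proof (induction k)
  case (Suc k)
  define P u where "P = proj n X k" and "u = app n P (X k)"
  have "trace n (proj n X (Suc k)) = trace n P - dot n u u / dot n u u"
    unfolding trace_def dot_def[of n u] sum_divide_distrib
    by (simp add: deflate_def dot_def sum_subtractf flip: P_def u_def)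
  then show ?case
    using Suc dot_self_eq_0[of n u] by (simp add: rank_Suc flip: P_def u_def)
qed (simp add: trace_def)

lemma rank_le: "rank n X k \<le> n"
  using trace_proj_nonneg[of n X k] by (simp add: trace_proj)

lemma rank_mono: "k \<le> l \<Longrightarrow> rank n X k \<le> rank n X l"
  by (rule lift_Suc_mono_le) (auto simp: rank_Suc)

text \<open>A vector that does not raise the rank lies in the span of its predecessors, so
  orthogonality passes on to it.\<close>

lemma rank_eq_orthogonal:
  assumes "rank n X l = rank n X k" "\<And>t. t < k \<Longrightarrow> dot n c (X t) = 0" "t < l"
  shows "dot n c (X t) = 0"
  using assms(3)
proof (induction t rule: less_induct)
  case (less t)
  show ?case
  proof (cases "t < k")
    case True then show ?thesis by (rule assms(2))
  next
    case False
    then have "rank n X k \<le> rank n X t" "rank n X (Suc t) \<le> rank n X l"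
      using less.prems by (simp_all add: rank_mono)
    then have z: "\<not> nonzero n (app n (proj n X t) (X t))"
      using assms(1) by (auto simp: rank_Suc split: if_splits)
    have "dot n c (X t) = dot n (app n (proj n X t) c) (X t)"
      using less by (intro dot_cong) (simp_all add: proj_fix)
    also have "\<dots> = dot n c (app n (proj n X t) (X t))" by (simp add: dot_proj)
    also have "\<dots> = 0" using z by (rule dot_not_nonzero)
    finally show ?thesis .
  qed
qed

text \<open>If \<open>q\<close> is the first power that kills \<open>c\<close>, then the
  \<open>q\<close> vectors before it in the chain are independent, which forces
  \<open>q \<le> n\<close>.\<close>

lemma app_pow_stable:
  assumes "nonzero n ((app n M ^^ n) c)"
  shows "nonzero n ((app n M ^^ (n + j)) c)"
proof (rule ccontr)
  assume "\<not> nonzero n ((app n M ^^ (n + j)) c)"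
  define q where "q = (LEAST q. \<not> nonzero n ((app n M ^^ q) c))"
  have q: "\<not> nonzero n ((app n M ^^ q) c)"
    unfolding q_def by (rule LeastI) fact
  have below: "nonzero n ((app n M ^^ r) c)" if "r < q" for r
    using not_less_Least[of r "\<lambda>q. \<not> nonzero n ((app n M ^^ q) c)"] that by (auto simp: q_def)
  have above: "\<not> nonzero n ((app n M ^^ r) c)" if "q \<le> r" for r
    using app_pow_not_nonzero[OF q, of "r - q" M] that
    by (simp flip: funpow_add[unfolded comp_def, THEN fun_cong])
  have "n < q" using above[of n] assms by (meson not_le)
  \<comment> \<open>The chain is listed backwards: the power \<open>t\<close> of the matrix kills
    every earlier \<open>X s\<close> but takes \<open>X t\<close> to the last nonzero vector, so
    \<open>X t\<close> is no combination of them.\<close>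
  define X where "X t = (app n M ^^ (q - 1 - t)) c" for t
  have "nonzero n (app n (proj n X t) (X t))" if "t < q" for t
  proof (rule ccontr)
    assume z: "\<not> nonzero n (app n (proj n X t) (X t))"
    obtain a where a: "\<And>i. i < n \<Longrightarrow> X t i - app n (proj n X t) (X t) i = (\<Sum>s<t. a s * X s i)"
      using proj_span[of n "X t" X t] by auto
    have pow: "(app n M ^^ t) (X s) = (app n M ^^ (t + (q - 1 - s))) c" for s
      by (simp add: X_def funpow_add)
    have lin: "X t i = (\<Sum>s<t. a s * X s i)" if "i < n" for i
      using a[OF that] z that by (simp add: nonzero_def)
    have eq: "(app n M ^^ t) (X t) i = (\<Sum>s<t. a s * (app n M ^^ t) (X s) i)" if "i < n" for i
      using app_pow_cong[of n "X t", OF lin that] by (simp add: app_pow_sum)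
    have "nonzero n ((app n M ^^ t) (X t))"
      unfolding pow using that by (intro below) simp
    moreover have "\<not> nonzero n (\<lambda>i. \<Sum>s<t. a s * (app n M ^^ t) (X s) i)"
      using above that unfolding nonzero_def pow
      by (auto intro!: sum.neutral)
    ultimately show False by (auto simp: nonzero_def eq)
  qed
  then have "{t. t < q \<and> nonzero n (app n (proj n X t) (X t))} = {..<q}" by auto
  then have "rank n X q = q" by (simp add: rank_def)
  then show False using rank_le[of n X q] \<open>n < q\<close> by simp
qed


section \<open>Bounding the search\<close>

text \<open>With \<open>g\<close> the previous value, the next window holds \<open>m ^ g + 1\<close>
  blocks of \<open>g\<close> starting points and \<open>g\<close> more places to complete a word
  begun in the last block; two of the words of length \<open>g\<close> must agree.\<close>

primrec grow :: "nat \<Rightarrow> nat \<Rightarrow> nat \<Rightarrow> nat" where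
  "grow m a 0 = a"
| "grow m a (Suc j) = grow m a j * (m ^ grow m a j + 2)"

lemma grow_ge: "a \<le> grow m a j"
  by (induction j) (auto intro: order_trans)

lemma word_repeats:
  fixes e :: "nat \<Rightarrow> 'a" and pos :: "nat \<Rightarrow> nat"
  assumes "finite D" "\<And>q k. q \<le> card D ^ l \<Longrightarrow> k < l \<Longrightarrow> e (pos q + k) \<in> D"
  obtains q q' where "q < q'" "q' \<le> card D ^ l" "\<And>k. k < l \<Longrightarrow> e (pos q + k) = e (pos q' + k)"
proof -
  define f where "f q = map (\<lambda>k. e (pos q + k)) [0..<l]" for q
  have "f ` {..card D ^ l} \<subseteq> {xs. set xs \<subseteq> D \<and> length xs = l}"
    using assms(2) by (auto simp: f_def)
  then have "card (f ` {..card D ^ l}) \<le> card D ^ l"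
    using card_mono[OF finite_lists_length_eq[OF assms(1)]] card_lists_length_eq[OF assms(1)]
    by metis
  then have "\<not> inj_on f {..card D ^ l}"
    by (intro pigeonhole) simp
  then obtain q q' where "q < q'" "q' \<le> card D ^ l" "f q = f q'"
    unfolding inj_on_def by (metis atMost_iff linorder_neqE_nat)
  moreover from \<open>f q = f q'\<close> have "e (pos q + k) = e (pos q' + k)" if "k < l" for k
    using that by (auto simp: f_def)
  ultimately show thesis using that by blast
qed

section \<open>Orbits of the input vector and periodic continuation of signals\<close>

locale input_orbit =
  fixes n :: nat and M :: "nat \<Rightarrow> nat \<Rightarrow> real" and b :: "nat \<Rightarrow> real"
begin

definition orbit :: "nat \<Rightarrow> nat \<Rightarrow> real" where
  "orbit k = (app n M ^^ k) b"

definition dual :: "nat \<Rightarrow> (nat \<Rightarrow> real) \<Rightarrow> nat \<Rightarrow> real" where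
  "dual k c = (app n (tr M) ^^ k) c"

text \<open>\<open>bad \<sigma> T\<close>: the inputs delivered up to time \<open>T\<close> do not span the state space.\<close>

definition bad :: "(nat \<Rightarrow> nat) \<Rightarrow> nat \<Rightarrow> bool" where
  "bad \<sigma> T \<longleftrightarrow> (\<exists>c. nonzero n c \<and>
     (\<forall>t\<le>T. t + \<sigma> t \<le> T \<longrightarrow> dot n c (orbit (T - (t + \<sigma> t))) = 0))"

lemma dual_dual: "dual k (dual l c) = dual (k + l) c"
  by (simp add: dual_def funpow_add)

lemma dot_dual: "dot n (dual k c) (orbit j) = dot n c (orbit (k + j))"
  by (simp add: dual_def orbit_def funpow_add dot_app_pow)

lemma dot_dual_pow: "dot n (dual k c) x = dot n c ((app n M ^^ k) x)"
  by (simp add: dual_def dot_app_pow)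

lemma dual_stable: "nonzero n (dual n c) \<Longrightarrow> n \<le> k \<Longrightarrow> nonzero n (dual k c)"
  using app_pow_stable[of n "tr M" c "k - n"] by (simp add: dual_def)

text \<open>Consider the solution spaces of the linear conditions imposed along a window of labels. When
  a word recurs within a stretch that does not shrink the solution space, that space is
  invariant under a power of the matrix, and the labels can be continued periodically. If this
  never happened, the rank of the conditions would exceed \<open>n\<close>.\<close>

lemma periodic_labels:
  fixes e :: "nat \<Rightarrow> 'a" and \<phi> :: "'a \<Rightarrow> nat \<Rightarrow> real"
  assumes D: "finite D" and e: "\<And>k. k < L \<Longrightarrow> e k \<in> D"
    and zero: "\<And>k. k < L \<Longrightarrow> dot n (\<phi> (e k)) (orbit k) = 0"
    and a: "0 < a" and L: "2 * grow (card D) a (Suc n) \<le> L"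
  obtains i p where "0 < p" "i + p \<le> L"
    "\<And>k. i \<le> k \<Longrightarrow> dot n (\<phi> (e (i + (k - i) mod p))) (orbit k) = 0"
proof -
  \<comment> \<open>The condition on \<open>orbit (i + k)\<close> is pulled back to
    \<open>orbit i\<close>, so that a whole window becomes a list of conditions on one
    vector.\<close>
  define Y where "Y i k = dual k (\<phi> (e (i + k)))" for i k
  define G where "G = grow (card D) a"
  \<comment> \<open>A word of length \<open>l\<close> recurs at distance \<open>p\<close>, and the
    next \<open>p\<close> conditions do not raise the rank.\<close>
  define good where "good i p l \<longleftrightarrow> 0 < p \<and> i + l + p \<le> L \<and>
      (\<forall>k<l. e (i + k) = e (i + p + k)) \<and> rank n (Y i) (l + p) = rank n (Y i) l" for i p l
  have "\<exists>i p l. good i p l"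
  proof (rule ccontr)
    assume bad: "\<nexists>i p l. good i p l"
    \<comment> \<open>Each level of \<open>G\<close> gains one unit of rank. The factor 2 leaves
      room for a start anywhere before \<open>s + G j\<close> followed by \<open>G j\<close>
      labels.\<close>
    have "\<exists>i\<ge>s. i < s + G j \<and> j \<le> rank n (Y i) (G j)" if "s + 2 * G j \<le> L" for s j
      using that
    proof (induction j arbitrary: s)
      case 0
      then show ?case using a by (intro exI[of _ s]) (simp add: G_def)
    next
      case (Suc j)
      define g where "g = G j"
      have G_Suc: "G (Suc j) = g * card D ^ g + 2 * g"
        by (simp add: G_def g_def algebra_simps)
      \<comment> \<open>One start of rank at least \<open>j\<close> in each block of length
        \<open>g\<close>. Two of them carry the same word, and as this recurrence is not good, the
        rank rises before the second word ends.\<close>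
      have "\<exists>i\<ge>s + q * g. i < s + q * g + g \<and> j \<le> rank n (Y i) g" if "q \<le> card D ^ g" for q
      proof -
        have "q * g \<le> g * card D ^ g" using that by simp
        moreover have "s + x + 2 * g \<le> L" if "x \<le> y" "s + 2 * (y + 2 * g) \<le> L" for x y
          using that by simp
        ultimately have "s + q * g + 2 * g \<le> L" using Suc.prems unfolding G_Suc by blast
        then show ?thesis using Suc.IH[of "s + q * g"] by (simp flip: g_def)
      qed
      then obtain pos where pos: "\<And>q. q \<le> card D ^ g \<Longrightarrow>
          s + q * g \<le> pos q \<and> pos q < s + q * g + g \<and> j \<le> rank n (Y (pos q)) g"
        by metis
      have room: "pos q + g \<le> s + G (Suc j)" if "q \<le> card D ^ g" for q
      proof -
        have "q * g \<le> g * card D ^ g" using that by simp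
        then show ?thesis using pos[OF that] unfolding G_Suc by linarith
      qed
      have "e (pos q + k) \<in> D" if "q \<le> card D ^ g" "k < g" for q k
        using room[OF that(1)] that(2) Suc.prems by (intro e) simp
      then obtain q q' where q: "q < q'" "q' \<le> card D ^ g"
          "\<And>k. k < g \<Longrightarrow> e (pos q + k) = e (pos q' + k)"
        using word_repeats[OF D] by metis
      have "Suc q * g \<le> q' * g" using q(1) by (intro mult_right_mono) simp_all
      then have less: "pos q < pos q'" using pos[of q] pos[of q'] q by simp
      define p where "p = pos q' - pos q"
      have "s \<le> pos q" using pos[of q] q by simp
      then have p: "0 < p" "pos q + p = pos q'" "g + p \<le> G (Suc j)"
        using less room[of q'] q(2) by (simp_all add: p_def)
      have "pos q + g + p \<le> L" using room[of q'] q(2) Suc.prems p(2) by simp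
      moreover have "\<not> good (pos q) p g" using bad by blast
      ultimately have "rank n (Y (pos q)) (g + p) \<noteq> rank n (Y (pos q)) g"
        using p(1) q(3) by (simp add: good_def p(2))
      then have "j < rank n (Y (pos q)) (g + p)"
        using pos[of q] q rank_mono[of g "g + p" n "Y (pos q)"] by simp
      then have "Suc j \<le> rank n (Y (pos q)) (G (Suc j))"
        using rank_mono[OF p(3), of n "Y (pos q)"] by simp
      moreover have "pos q < s + G (Suc j)" using less room[of q'] q(2) by simp
      ultimately show ?case using \<open>s \<le> pos q\<close> by blast
    qed
    from this[of 0 "Suc n"] obtain i where "Suc n \<le> rank n (Y i) (G (Suc n))"
      using L by (auto simp: G_def)
    then show False using rank_le[of n "Y i" "G (Suc n)"] by simp
  qed
  then obtain i p l where good: "good i p l" by blast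
  \<comment> \<open>The solution space of the first \<open>l\<close> conditions. It is invariant
    under the \<open>p\<close>-th power: condition \<open>k\<close> on the image of a vector is
    condition \<open>p + k\<close> on the vector itself, because the labels agree, and that one
    holds since the rank does not rise.\<close>
  define U where "U x \<longleftrightarrow> (\<forall>k<l. dot n (Y i k) x = 0)" for x
  have U_more: "dot n (Y i k) x = 0" if "U x" "k < l + p" for x k
    using rank_eq_orthogonal[of n "Y i" "l + p" l x k] good that
    by (simp add: good_def U_def dot_commute)
  have U_step: "U ((app n M ^^ p) x)" if "U x" for x
    unfolding U_def
  proof (intro allI impI)
    fix k assume k: "k < l"
    have "dot n (Y i k) ((app n M ^^ p) x) = dot n (dual (p + k) (\<phi> (e (i + k)))) x"
      by (simp add: Y_def flip: dot_dual_pow dual_dual)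
    also have "\<dots> = dot n (Y i (p + k)) x"
      using good k by (simp add: Y_def good_def add.assoc)
    also have "\<dots> = 0" using U_more[OF that] k by simp
    finally show "dot n (Y i k) ((app n M ^^ p) x) = 0" .
  qed
  have U_orbit: "U (orbit (i + q * p))" for q
  proof (induction q)
    case 0
    have "dot n (\<phi> (e (i + k))) (orbit (i + k)) = 0" if "k < l" for k
      using good that by (intro zero) (simp add: good_def)
    then show ?case by (simp add: U_def Y_def dot_dual add.commute)
  next
    case (Suc q)
    have "orbit (i + Suc q * p) = (app n M ^^ p) (orbit (i + q * p))"
      by (simp add: orbit_def add.left_commute flip: funpow_add[THEN fun_cong, unfolded comp_def])
    then show ?case using U_step[OF Suc] by simp
  qed
  have "dot n (\<phi> (e (i + (k - i) mod p))) (orbit k) = 0" if "i \<le> k" for k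
  proof -
    define r q where "r = (k - i) mod p" and "q = (k - i) div p"
    have k: "k = r + (i + q * p)"
      using that by (simp add: r_def q_def)
    have "r < l + p" using good by (simp add: r_def good_def trans_less_add2)
    then have "dot n (Y i r) (orbit (i + q * p)) = 0"
      using U_more U_orbit by blast
    then show ?thesis by (simp add: Y_def dot_dual flip: r_def k)
  qed
  then show thesis using that[of p i] good by (simp add: good_def)
qed

text \<open>A single functional at time \<open>T1\<close> yields one condition on the orbit per
  sending time. Read backwards, these are conditions labelled by delays, as
  \<open>periodic_labels\<close> requires. As \<open>dual n c\<close> is nonzero, all further
  pull-backs are nonzero too and serve as witnesses for the new signal.\<close>

lemma bad_forever_of_invertible_part:
  assumes D: "finite D" "\<And>e. e \<in> D \<Longrightarrow> e \<le> d" and \<sigma>: "\<And>t. t \<le> T1 \<Longrightarrow> \<sigma> t \<in> D"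
    and c: "nonzero n (dual n c)"
    and orth: "\<And>t. t \<le> T1 \<Longrightarrow> t + \<sigma> t \<le> T1 \<Longrightarrow> dot n (dual n c) (orbit (T1 - (t + \<sigma> t))) = 0"
    and a: "0 < a" and T1: "d + 2 * grow (card D) a (Suc n) \<le> T1"
  obtains \<sigma>' where "range \<sigma>' \<subseteq> D" "\<And>T. bad \<sigma>' T"
proof -
  \<comment> \<open>Starting at \<open>T1 - d\<close> ensures that each input is delivered by
    \<open>T1\<close>, whatever its delay; a delay below \<open>d\<close> shows up as an additional
    pull-back by the difference.\<close>
  define e where "e k = \<sigma> (T1 - d - k)" for k
  have len: "2 * grow (card D) a (Suc n) \<le> T1 - d" using T1 by simp
  have e: "e k \<in> D" for k by (simp add: e_def \<sigma>)
  have zero: "dot n (dual (d - e k) (dual n c)) (orbit k) = 0" if "k < T1 - d" for k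
  proof -
    have le: "e k \<le> d" using D(2) e by blast
    then have "T1 - d - k + \<sigma> (T1 - d - k) \<le> T1"
      and "T1 - (T1 - d - k + \<sigma> (T1 - d - k)) = d - e k + k"
      using that by (simp_all add: e_def)
    with orth[of "T1 - d - k"] show ?thesis by (simp add: dot_dual[of "d - e k"])
  qed
  obtain i p where p: "0 < p" and per: "\<And>k. i \<le> k \<Longrightarrow>
      dot n (dual (d - e (i + (k - i) mod p)) (dual n c)) (orbit k) = 0"
    by (rule periodic_labels[of D "T1 - d" e "\<lambda>l. dual (d - l) (dual n c)" a])
      (use D(1) e zero a len in blast)+
  define e' where "e' k = e (i + (k - i) mod p)" for k
  have e'_per: "e' (k + q * p) = e' k" if "i \<le> k" for k q
  proof -
    have "k + q * p - i = k - i + q * p" using that by simp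
    then show ?thesis by (simp add: e'_def)
  qed
  \<comment> \<open>\<open>K t\<close> is congruent to \<open>- t\<close> modulo \<open>p\<close>
    and lifted to at least \<open>i\<close>: the new signal runs through the periodic labels
    backwards.\<close>
  define K where "K t = (t + i) * p - t" for t
  have K: "i \<le> K t" "t \<le> (t + i) * p" for t
  proof -
    have "t + i \<le> (t + i) * p" using p by (cases p) simp_all
    then show "i \<le> K t" "t \<le> (t + i) * p" unfolding K_def by linarith+
  qed
  define \<sigma>' where "\<sigma>' t = e' (K t)" for t
  have "bad \<sigma>' T" for T
    unfolding bad_def
  proof (intro exI conjI allI impI)
    \<comment> \<open>The functional is pulled back so far that an input sent at \<open>t\<close>
      meets the condition at position \<open>K T + (T - t)\<close>, which differs from
      \<open>K t\<close> by whole periods.\<close>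
    show "nonzero n (dual (d + K T + n) c)" using c by (rule dual_stable) simp
    fix t assume t: "t \<le> T" "t + \<sigma>' t \<le> T"
    define k where "k = K T + (T - t)"
    have "k = K t + (T - t) * p"
    proof -
      have "(t + i) * p + (T - t) * p = (T + i) * p"
        using t(1) by (simp flip: add_mult_distrib)
      then show ?thesis using K(2)[of t] K(2)[of T] t(1) unfolding k_def K_def by linarith
    qed
    then have e'k: "e' k = \<sigma>' t" using e'_per[OF K(1), of t "T - t"] by (simp add: \<sigma>'_def)
    have "\<sigma>' t \<le> d" by (simp add: \<sigma>'_def e'_def e D(2))
    then have "d + K T + n + (T - (t + \<sigma>' t)) = n + (d - e' k + k)"
      using t k_def unfolding e'k by linarith
    then have "dot n (dual (d + K T + n) c) (orbit (T - (t + \<sigma>' t)))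
        = dot n (dual (d - e' k) (dual n c)) (orbit k)"
      by (simp only: dot_dual)
    also have "\<dots> = 0"
      unfolding e'_def using K(1)[of T] by (intro per) (simp add: k_def)
    finally show "dot n (dual (d + K T + n) c) (orbit (T - (t + \<sigma>' t))) = 0" .
  qed
  moreover have "range \<sigma>' \<subseteq> D" by (auto simp: \<sigma>'_def e'_def e)
  ultimately show thesis using that by blast
qed

text \<open>If the functionals vanish on the invertible part, only the last \<open>n\<close> delivery times
  matter, which is a condition on windows of the switching signal.\<close>

lemma bad_forever_of_nilpotent_part:
  assumes D: "finite D" "\<And>e. e \<in> D \<Longrightarrow> e \<le> d" and \<sigma>: "\<And>t. t < N \<Longrightarrow> \<sigma> t \<in> D"
    and c: "\<And>T. T1 \<le> T \<Longrightarrow> T < N \<Longrightarrow> \<exists>c. nonzero n c \<and> \<not> nonzero n (dual n c) \<and>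
      (\<forall>t\<le>T. t + \<sigma> t \<le> T \<longrightarrow> dot n c (orbit (T - (t + \<sigma> t))) = 0)"
    and N: "T1 + card D ^ (n + d + 1) + (n + d + 1) \<le> N"
  obtains \<sigma>' where "range \<sigma>' \<subseteq> D" "\<And>T. bad \<sigma>' T"
proof -
  \<comment> \<open>Delays are at most \<open>d\<close>, so an input delivered within the last
    \<open>n\<close> steps was sent within the last \<open>n + d + 1\<close> times.\<close>
  define l where "l = n + d + 1"
  have "\<sigma> ((T1 + q) + k) \<in> D" if "q \<le> card D ^ l" "k < l" for q k
    using that N by (intro \<sigma>) (simp add: l_def)
  then obtain q q' where q: "q < q'" "q' \<le> card D ^ l"
      "\<And>k. k < l \<Longrightarrow> \<sigma> (T1 + q + k) = \<sigma> (T1 + q' + k)"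
    using word_repeats[OF D(1), of l \<sigma> "\<lambda>q. T1 + q"] by metis
  define i p where "i = T1 + q" and "p = q' - q"
  have p: "0 < p" "i + p = T1 + q'" using q by (simp_all add: i_def p_def)
  define \<sigma>' where "\<sigma>' t = \<sigma> (i + t mod p)" for t
  \<comment> \<open>The repeated word makes the signal agree with its shift by \<open>p\<close>,
    hence periodic along the whole window.\<close>
  have fold: "\<sigma> (i + k) = \<sigma>' k" if "k < p + l" for k
    using that
  proof (induction k rule: less_induct)
    case (less k)
    show ?case
    proof (cases "k < p")
      case True then show ?thesis by (simp add: \<sigma>'_def)
    next
      case False
      then obtain k' where k': "k = p + k'" by (metis le_add_diff_inverse not_less)
      have "i + k = T1 + q' + k'" using p(2) by (simp add: k')
      then have "\<sigma> (i + k) = \<sigma> (T1 + q' + k')" by simp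
      also have "\<dots> = \<sigma> (i + k')"
        using q(3)[of k'] less.prems by (simp add: k' i_def)
      also have "\<dots> = \<sigma>' k'" using less p(1) by (intro less.IH) (simp_all add: k')
      finally show ?thesis by (simp add: \<sigma>'_def k')
    qed
  qed
  have late: "bad \<sigma>' T" if "l \<le> T" for T
  proof -
    define t0 where "t0 = T - (n + d)"
    \<comment> \<open>Reducing the start \<open>t0\<close> modulo \<open>p\<close> moves the window
      into the stretch of the original signal covered by \<open>fold\<close>; the functional found
      there serves for \<open>T\<close>.\<close>
    define i' where "i' = i + t0 mod p"
    have T: "T = t0 + (n + d)" using that by (simp add: t0_def l_def)
    have "t0 mod p < p" using p(1) by simp
    then have i': "i \<le> i'" "i' < i + p" by (simp_all add: i'_def)
    then have "i' + (n + d) < N" using q(2) N p(2) by (simp add: l_def)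
    then obtain c where c: "nonzero n c" "\<not> nonzero n (dual n c)"
      and orth: "\<And>t. t \<le> i' + (n + d) \<Longrightarrow> t + \<sigma> t \<le> i' + (n + d) \<Longrightarrow>
        dot n c (orbit (i' + (n + d) - (t + \<sigma> t))) = 0"
      using assms(4)[of "i' + (n + d)"] i'(1) by (auto simp: i_def)
    have "dot n c (orbit (T - (t + \<sigma>' t))) = 0" if t: "t \<le> T" "t + \<sigma>' t \<le> T" for t
    proof (cases "T - (t + \<sigma>' t) < n")
      case False
      then obtain k where "T - (t + \<sigma>' t) = n + k" by (metis le_add_diff_inverse not_less)
      then show ?thesis using c(2) by (simp add: dot_not_nonzero flip: dot_dual)
    next
      case True
      have "\<sigma>' t \<in> D"
        unfolding \<sigma>'_def using p q(2) N
        by (intro \<sigma>) (simp add: l_def order_less_le_trans[OF add_strict_left_mono[OF mod_less_divisor]])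
      then have "\<sigma>' t \<le> d" by (rule D(2))
      with True t have "t0 \<le> t" by (simp add: T)
      define k where "k = t - t0"
      have t_eq: "t = t0 + k" using \<open>t0 \<le> t\<close> by (simp add: k_def)
      have "k \<le> n + d" using t(1) by (simp add: k_def T)
      then have "t0 mod p + k < p + l" using \<open>t0 mod p < p\<close> by (simp add: l_def)
      from fold[OF this] have "\<sigma> (i' + k) = \<sigma>' t"
        by (simp add: i'_def \<sigma>'_def t_eq mod_add_left_eq add.assoc)
      then show ?thesis
        using orth[of "i' + k"] t \<open>k \<le> n + d\<close> by (simp add: T t_eq)
    qed
    then show ?thesis using c(1) by (auto simp: bad_def)
  qed
  have "bad \<sigma>' T" for T
  proof -
    \<comment> \<open>Times below \<open>l\<close> are shifted by a multiple of the period: the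
      conditions at \<open>T\<close> are among those at the later time.\<close>
    have per: "\<sigma>' (t + l * p) = \<sigma>' t" for t by (simp add: \<sigma>'_def)
    have "l \<le> l * p" using p(1) by simp
    then have "l \<le> T + l * p" by (rule trans_le_add2)
    then obtain c where c: "nonzero n c" and orth: "\<And>t. t \<le> T + l * p \<Longrightarrow> t + \<sigma>' t \<le> T + l * p \<Longrightarrow>
        dot n c (orbit (T + l * p - (t + \<sigma>' t))) = 0"
      using late[of "T + l * p"] unfolding bad_def by blast
    have "dot n c (orbit (T - (t + \<sigma>' t))) = 0" if "t \<le> T" "t + \<sigma>' t \<le> T" for t
    proof -
      have "T + l * p - (t + l * p + \<sigma>' t) = T - (t + \<sigma>' t)" by simp
      then show ?thesis using orth[of "t + l * p"] that by (simp add: per)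
    qed
    then show ?thesis using c by (auto simp: bad_def)
  qed
  moreover have "\<sigma>' t \<in> D" for t
    unfolding \<sigma>'_def using p q(2) N
    by (intro \<sigma>) (simp add: l_def order_less_le_trans[OF add_strict_left_mono[OF mod_less_divisor]])
  ultimately show thesis using that by blast
qed

text \<open>Deciding the case at \<open>T1\<close> settles all later times: the functional of a time
  \<open>T \<ge> T1 + n\<close>, pulled back to \<open>T1\<close>, has the form
  \<open>dual n\<close> of something. If every such functional at \<open>T1\<close> vanishes, then
  by \<open>dual_stable\<close> the original one vanishes after \<open>n\<close> steps.\<close>

lemma bad_forever:
  assumes D: "finite D" "\<And>e. e \<in> D \<Longrightarrow> e \<le> d"
    and N: "N = 4 * grow (card D) (n + d + 1) (Suc n)"
    and \<sigma>: "\<And>t. t < N \<Longrightarrow> \<sigma> t \<in> D" and bad: "\<And>T. T < N \<Longrightarrow> bad \<sigma> T"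
  obtains \<sigma>' where "range \<sigma>' \<subseteq> D" "\<And>T. bad \<sigma>' T"
proof -
  define a where "a = n + d + 1"
  define g where "g = grow (card D) a (Suc n)"
  define T1 where "T1 = d + 2 * g"
  \<comment> \<open>Level 1 of \<open>grow\<close> already covers the
    \<open>card D ^ a + 2 * a\<close> steps that the nilpotent case may take beyond
    \<open>2 * g\<close>.\<close>
  have "a * (card D ^ a + 2) \<le> g"
    unfolding g_def
  proof (induction n)
    case (Suc n)
    then show ?case using grow_ge[of a "card D" "Suc n"]
      by (auto intro: order_trans)
  qed simp
  moreover have "card D ^ a \<le> a * card D ^ a" by (simp add: a_def)
  ultimately have g: "card D ^ a + 2 * a \<le> g" unfolding distrib_left by linarith
  have N': "T1 + n + card D ^ (n + d + 1) + (n + d + 1) \<le> N"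
    using g by (simp add: N T1_def g_def a_def)
  show thesis
  proof (cases "\<exists>c. nonzero n (dual n c) \<and>
      (\<forall>t\<le>T1. t + \<sigma> t \<le> T1 \<longrightarrow> dot n (dual n c) (orbit (T1 - (t + \<sigma> t))) = 0)")
    case True
    then obtain c where c: "nonzero n (dual n c)"
      "\<And>t. t \<le> T1 \<Longrightarrow> t + \<sigma> t \<le> T1 \<Longrightarrow> dot n (dual n c) (orbit (T1 - (t + \<sigma> t))) = 0" by blast
    show thesis
    proof (rule bad_forever_of_invertible_part[OF D, of T1 \<sigma> c a])
      show "\<sigma> t \<in> D" if "t \<le> T1" for t using that N' by (intro \<sigma>) simp
    qed (use c that in \<open>simp_all add: T1_def g_def a_def\<close>)
  next
    case False
    show thesis
    proof (rule bad_forever_of_nilpotent_part[OF D, of N \<sigma> "T1 + n"])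
      fix T assume T: "T1 + n \<le> T" "T < N"
      obtain c where c: "nonzero n c"
        and orth: "\<And>t. t \<le> T \<Longrightarrow> t + \<sigma> t \<le> T \<Longrightarrow> dot n c (orbit (T - (t + \<sigma> t))) = 0"
        using bad[OF T(2)] by (auto simp: bad_def)
      define r where "r = T - T1 - n"
      have "dual n (dual r c) = dual (T - T1) c" using T by (simp add: dual_dual r_def)
      moreover have "dot n (dual (T - T1) c) (orbit (T1 - (t + \<sigma> t))) = 0"
        if "t \<le> T1" "t + \<sigma> t \<le> T1" for t
        using orth[of t] that T by (simp add: dot_dual)
      ultimately have "\<not> nonzero n (dual (T - T1) c)"
        using False by metis
      then have "\<not> nonzero n (dual n c)"
        using dual_stable[of c "T - T1"] le_diff_conv2[of T1 T n] T by (auto simp: add.commute)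
      then show "\<exists>c. nonzero n c \<and> \<not> nonzero n (dual n c) \<and>
          (\<forall>t\<le>T. t + \<sigma> t \<le> T \<longrightarrow> dot n c (orbit (T - (t + \<sigma> t))) = 0)"
        using c orth by blast
    qed (use \<sigma> N' that in simp_all)
  qed
qed

end


section \<open>Controllability as a spanning condition\<close>

context input_orbit
begin

text \<open>The state at time \<open>t\<close> produced by a unit input sent at \<open>t'\<close>.
  An input delivered at \<open>T\<close> first enters the state at \<open>Suc T\<close>, whence the
  shift against \<open>bad\<close>. Inputs still under way count as zero vectors, so that the test
  runs over an initial segment of sending times.\<close>

definition delivered :: "(nat \<Rightarrow> nat) \<Rightarrow> nat \<Rightarrow> nat \<Rightarrow> nat \<Rightarrow> real" where
  "delivered \<sigma> t t' =
     (if t' + \<sigma> t' < t then orbit (t - Suc (t' + \<sigma> t')) else (\<lambda>i. 0))"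

lemma bad_iff: "bad \<sigma> T \<longleftrightarrow> 0 < trace n (proj n (delivered \<sigma> (Suc T)) (Suc T))"
  unfolding trace_proj_pos_iff bad_def delivered_def
  by (intro ex_cong1 conj_cong refl all_cong1)
    (auto simp: dot_def[of _ _ "\<lambda>i. 0"] less_Suc_eq_le)

end

context
  fixes n :: nat and A :: "real mat" and b :: "real vec"
  assumes A: "A \<in> carrier_mat n n" and b: "b \<in> carrier_vec n"
begin

interpretation input_orbit n "\<lambda>i j. A $$ (i, j)" "\<lambda>i. b $ i" .

abbreviation (input) "M \<equiv> \<lambda>i j. A $$ (i, j)"

lemma trajectory_carrier:
  "x0 \<in> carrier_vec n \<Longrightarrow> trajectory A b \<sigma> v x0 t \<in> carrier_vec n"
  using A b by (induction t) auto

lemma delivered_Suc: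
  "delivered \<sigma> (Suc t) t' i = app n M (delivered \<sigma> t t') i + (if t' + \<sigma> t' = t then b $ i else 0)"
proof -
  consider "t' + \<sigma> t' < t" | "t' + \<sigma> t' = t" | "t' + \<sigma> t' > t" by linarith
  then show ?thesis
  proof cases
    case 1
    then have "t - (t' + \<sigma> t') = Suc (t - Suc (t' + \<sigma> t'))" by simp
    then show ?thesis using 1 by (simp add: delivered_def orbit_def del: diff_Suc_Suc)
  qed (simp_all add: delivered_def orbit_def app_def)
qed

lemma trajectory_eq:
  assumes x0: "x0 \<in> carrier_vec n" and "i < n"
  shows "trajectory A b \<sigma> v x0 t $ i =
     (app n M ^^ t) (\<lambda>i. x0 $ i) i + (\<Sum>t'<t. v t' * delivered \<sigma> t t' i)"
  using assms(2)
proof (induction t arbitrary: i)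
  case (Suc t)
  define z where "z = trajectory A b \<sigma> v x0 t"
  have z: "z \<in> carrier_vec n" unfolding z_def by (rule trajectory_carrier) fact
  have "(A *\<^sub>v z) $ i = app n M (\<lambda>i. z $ i) i"
    using A z Suc.prems by (simp add: app_def scalar_prod_def atLeast0LessThan)
  also have "app n M (\<lambda>i. z $ i) =
      app n M (\<lambda>i. (app n M ^^ t) (\<lambda>i. x0 $ i) i + (\<Sum>t'<t. v t' * delivered \<sigma> t t' i))"
    by (rule app_cong) (simp add: z_def Suc.IH)
  also have "\<dots> i = (app n M ^^ Suc t) (\<lambda>i. x0 $ i) i + (\<Sum>t'<t. v t' * app n M (delivered \<sigma> t t') i)"
    by (simp add: app_add app_sum)
  also have "(\<Sum>t'<t. v t' * app n M (delivered \<sigma> t t') i) = (\<Sum>t'<Suc t. v t' * app n M (delivered \<sigma> t t') i)"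
    by (simp add: delivered_def app_def)
  finally have "(A *\<^sub>v z) $ i = (app n M ^^ Suc t) (\<lambda>i. x0 $ i) i +
      (\<Sum>t'<Suc t. v t' * app n M (delivered \<sigma> t t') i)" .
  moreover have "(\<Sum>t' | t' \<le> t \<and> t' + \<sigma> t' = t. v t') * b $ i =
      (\<Sum>t'<Suc t. v t' * (if t' + \<sigma> t' = t then b $ i else 0))"
  proof -
    have "{t'. t' \<le> t \<and> t' + \<sigma> t' = t} = {t' \<in> {..<Suc t}. t' + \<sigma> t' = t}" by auto
    then have "(\<Sum>t' | t' \<le> t \<and> t' + \<sigma> t' = t. v t') =
        (\<Sum>t'<Suc t. if t' + \<sigma> t' = t then v t' else 0)"
      by (simp only: sum.inter_filter[OF finite_lessThan])
    then show ?thesis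
      by (simp only: sum_distrib_right) (rule sum.cong, auto)
  qed
  moreover have "trajectory A b \<sigma> v x0 (Suc t) $ i =
      (A *\<^sub>v z) $ i + (\<Sum>t' | t' \<le> t \<and> t' + \<sigma> t' = t. v t') * b $ i"
    using A b z Suc.prems by (simp flip: z_def)
  ultimately show ?case
    by (simp only: delivered_Suc distrib_left sum.distrib add.assoc)
qed simp

text \<open>Countably many proper subspaces cannot cover the moment curve, since each meets it in
  finitely many points.\<close>

lemma moment_curve_avoids:
  fixes c :: "nat \<Rightarrow> nat \<Rightarrow> real"
  assumes "\<And>T. nonzero n (c T)"
  obtains s where "\<And>T. dot n (c T) (\<lambda>i. s ^ i) \<noteq> 0"
proof -
  have "finite {s. dot n (c T) (\<lambda>i. s ^ i) = 0}" for T
  proof -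
    obtain k where k: "k < n" "c T k \<noteq> 0" using assms by (auto simp: nonzero_def)
    then have "{..<n} = {..n - 1}" by auto
    then show ?thesis
      using polyfun_roots_finite[of "c T" k "n - 1"] k by (simp add: dot_def)
  qed
  then have "countable (\<Union>T. {s. dot n (c T) (\<lambda>i. s ^ i) = 0})"
    by (intro countable_UN) (auto intro: countable_finite)
  then have "(\<Union>T. {s. dot n (c T) (\<lambda>i. s ^ i) = 0}) \<noteq> UNIV"
    using uncountable_UNIV_real by metis
  then show thesis using that by blast
qed

text \<open>From the start 0 there is no free motion, so every state reachable at time
  \<open>Suc T\<close> is annihilated by \<open>c T\<close>.\<close>

lemma not_controllableI:
  assumes "range \<sigma> \<subseteq> D" "\<And>T. bad \<sigma> T"
  shows "\<not> controllable A b D"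
proof
  assume ctrl: "controllable A b D"
  obtain c where c: "\<And>T. nonzero n (c T)"
    "\<And>T t. t < Suc T \<Longrightarrow> dot n (c T) (delivered \<sigma> (Suc T) t) = 0"
    using assms(2) unfolding bad_iff trace_proj_pos_iff by metis
  obtain s where s: "\<And>T. dot n (c T) (\<lambda>i. s ^ i) \<noteq> 0"
    using moment_curve_avoids[of c] c(1) by blast
  have "n > 0" using c(1)[of 0] by (auto simp: nonzero_def)
  define xf where "xf = vec n (\<lambda>i. s ^ i)"
  obtain v t where vt: "trajectory A b \<sigma> v (0\<^sub>v n) t = xf"
    using ctrl b assms(1) unfolding controllable_def by (fastforce simp: xf_def)
  show False
  proof (cases t)
    \<comment> \<open>At time 0 the state is still 0, whereas coordinate 0 of the target is
      \<open>s ^ 0 = 1\<close>.\<close>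
    case 0
    then have "0\<^sub>v n $ 0 = xf $ 0" using vt by simp
    then show False using \<open>n > 0\<close> by (simp add: xf_def)
  next
    case (Suc T)
    have "s ^ i = (\<Sum>t'<t. v t' * delivered \<sigma> t t' i)" if "i < n" for i
    proof -
      have "(app n M ^^ t) (\<lambda>i. 0\<^sub>v n $ i) i = 0"
        using app_pow_not_nonzero[where x = "\<lambda>i. 0\<^sub>v n $ i" and M = M and k = t and n = n] that by (auto simp: nonzero_def)
      then show ?thesis
        using trajectory_eq[of "0\<^sub>v n" i \<sigma> v t] that by (simp add: vt xf_def)
    qed
    then have "dot n (c T) (\<lambda>i. s ^ i) = (\<Sum>i<n. \<Sum>t'<t. c T i * (v t' * delivered \<sigma> t t' i))"
      by (simp add: dot_def sum_distrib_left)
    also have "\<dots> = (\<Sum>t'<t. \<Sum>i<n. c T i * (v t' * delivered \<sigma> t t' i))" by (rule sum.swap)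
    also have "\<dots> = (\<Sum>t'<t. v t' * dot n (c T) (delivered \<sigma> t t'))"
      by (simp add: dot_def sum_distrib_left mult.left_commute)
    also have "\<dots> = 0" using c(2) by (simp add: Suc del: sum.lessThan_Suc)
    finally show False using s by blast
  qed
qed

lemma controllableI:
  assumes "\<And>\<sigma>. range \<sigma> \<subseteq> D \<Longrightarrow> \<exists>T. \<not> bad \<sigma> T"
  shows "controllable A b D"
  unfolding controllable_def
proof (intro allI impI ballI)
  fix \<sigma> :: "nat \<Rightarrow> nat" and x0 xf :: "real vec"
  assume "range \<sigma> \<subseteq> D" and x0: "x0 \<in> carrier_vec (dim_vec b)" and xf: "xf \<in> carrier_vec (dim_vec b)"
  then obtain T where "\<not> bad \<sigma> T" using assms by blast
  define P where "P = proj n (delivered \<sigma> (Suc T)) (Suc T)"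
  have "trace n P = 0"
    using \<open>\<not> bad \<sigma> T\<close> trace_proj_nonneg[of n "delivered \<sigma> (Suc T)" "Suc T"] by (simp add: bad_iff P_def)
  then have P0: "app n P y i = 0" if "i < n" for y i
    using that unfolding P_def trace_proj_eq_0 app_def by simp
  \<comment> \<open>What the inputs must add to the free motion; the vanishing projection turns it
    into a combination of delivered vectors.\<close>
  define y where "y i = xf $ i - (app n M ^^ Suc T) (\<lambda>i. x0 $ i) i" for i
  obtain v where v: "\<And>i. i < n \<Longrightarrow> y i = (\<Sum>t<Suc T. v t * delivered \<sigma> (Suc T) t i)"
    using proj_span[of n y "delivered \<sigma> (Suc T)" "Suc T"] P0 unfolding P_def[symmetric] by auto
  have x0n: "x0 \<in> carrier_vec n" and xfn: "xf \<in> carrier_vec n" using x0 xf b by auto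
  have "trajectory A b \<sigma> v x0 (Suc T) = xf"
  proof (rule eq_vecI)
    show "dim_vec (trajectory A b \<sigma> v x0 (Suc T)) = dim_vec xf"
      using trajectory_carrier[OF x0n, of \<sigma> v "Suc T"] xfn by (metis carrier_vecD)
    fix i assume "i < dim_vec xf"
    then have i: "i < n" using xfn by simp
    show "trajectory A b \<sigma> v x0 (Suc T) $ i = xf $ i"
      unfolding trajectory_eq[OF x0n i] v[OF i, symmetric] by (simp add: y_def)
  qed
  then show "\<exists>v t. trajectory A b \<sigma> v x0 t = xf" by blast
qed

lemma controllable_iff_bounded:
  assumes D: "finite D" "\<And>e. e \<in> D \<Longrightarrow> e \<le> d"
    and N: "N = 4 * grow (card D) (n + d + 1) (Suc n)"
  shows "controllable A b D \<longleftrightarrow>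
    (\<forall>\<sigma>. (\<forall>t<N. \<sigma> t \<in> D) \<longrightarrow> (\<exists>T<N. \<not> 0 < trace n (proj n (delivered \<sigma> (Suc T)) (Suc T))))"
proof
  assume ctrl: "controllable A b D"
  show "\<forall>\<sigma>. (\<forall>t<N. \<sigma> t \<in> D) \<longrightarrow> (\<exists>T<N. \<not> 0 < trace n (proj n (delivered \<sigma> (Suc T)) (Suc T)))"
  proof (intro allI impI, rule ccontr)
    fix \<sigma> assume \<sigma>: "\<forall>t<N. \<sigma> t \<in> D"
      and "\<not> (\<exists>T<N. \<not> 0 < trace n (proj n (delivered \<sigma> (Suc T)) (Suc T)))"
    then have "bad \<sigma> T" if "T < N" for T using that by (auto simp: bad_iff)
    then obtain \<sigma>' where "range \<sigma>' \<subseteq> D" "\<And>T. bad \<sigma>' T"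
      using bad_forever[OF D N, of \<sigma>] \<sigma> by blast
    then show False using not_controllableI ctrl by blast
  qed
next
  assume "\<forall>\<sigma>. (\<forall>t<N. \<sigma> t \<in> D) \<longrightarrow> (\<exists>T<N. \<not> 0 < trace n (proj n (delivered \<sigma> (Suc T)) (Suc T)))"
  then show "controllable A b D"
    unfolding bad_iff[symmetric] by (intro controllableI) blast
qed

end


section \<open>A small language of counting loops\<close>

text \<open>Program variables live behind the input, at run-time addresses, since the length of the
  list of delays is not known in advance.\<close>

definition dimE :: nexp where "dimE = NCell (NConst 0)"

definition cardE :: nexp where "cardE = NCell (NConst 1)"

definition addr :: "nat \<Rightarrow> nexp" where
  "addr c = NAdd cardE (NConst (c + 2))"

definition V :: "nat \<Rightarrow> nexp" where
  "V c = NCell (addr c)"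

definition For :: "nat \<Rightarrow> nexp \<Rightarrow> prog \<Rightarrow> prog" where
  "For x e body = Seq (NStore (addr x) (NConst 0))
     (While (NLess (V x) e) (Seq body (NStore (addr x) (NAdd (V x) (NConst 1)))))"

definition Sum :: "nexp \<Rightarrow> nat \<Rightarrow> nexp \<Rightarrow> rexp \<Rightarrow> prog" where
  "Sum dst x e f = Seq (RStore dst RZero) (For x e (RStore dst (RAdd (RCell dst) f)))"

definition Pow :: prog where
  "Pow = Seq (NStore (addr 1) (NConst 1))
     (For 2 (V 0) (NStore (addr 1) (NMult (V 1) cardE)))"

text \<open>A frame condition: \<open>S\<close> collects the variables that a program may
  change.\<close>

definition agree :: "nat set \<Rightarrow> (nat \<Rightarrow> nat) \<Rightarrow> (nat \<Rightarrow> nat) \<Rightarrow> bool" where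
  "agree S vs vs' \<longleftrightarrow> (\<forall>c. c \<notin> S \<longrightarrow> vs' c = vs c)"

lemma agreeD: "agree S vs vs' \<Longrightarrow> c \<notin> S \<Longrightarrow> vs' c = vs c"
  by (simp add: agree_def)

locale machine =
  fixes n :: nat and D :: "nat set"
  assumes finite_D: "finite D"
begin

abbreviation "m \<equiv> card D"

definition delay :: "nat \<Rightarrow> nat" where
  "delay k = sorted_list_of_set D ! k"

text \<open>The states whose input part is intact; \<open>vs\<close> fills the memory behind the
  delays.\<close>

definition emb :: "(nat \<Rightarrow> nat) \<Rightarrow> (nat \<Rightarrow> real) \<Rightarrow> state" where
  "emb vs g = (\<lambda>k. if k = 0 then n else if k = 1 then m else if k < m + 2 then delay (k - 2)
      else vs (k - (m + 2)), g)"

lemma input_state_emb: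
  "input_state n A b D = emb (\<lambda>_. 0) (snd (input_state n A b D))"
  by (auto simp: input_state_def emb_def delay_def fun_eq_iff)

lemma snd_emb [simp]: "snd (emb vs g) = g"
  by (simp add: emb_def)

lemma nval_dim [simp]: "nval dimE (emb vs g) = n"
  and nval_card [simp]: "nval cardE (emb vs g) = m"
  and nval_addr [simp]: "nval (addr c) (emb vs g) = m + 2 + c"
  and nval_V [simp]: "nval (V c) (emb vs g) = vs c"
  by (simp_all add: emb_def addr_def V_def dimE_def cardE_def)

lemma nval_delay: "k < m \<Longrightarrow> nval (NCell e) (emb vs g) = delay k" if "nval e (emb vs g) = k + 2"
  using that by (simp add: emb_def)

lemma emb_upd: "((fst (emb vs g))(m + 2 + c := k), h) = emb (vs(c := k)) h"
  by (auto simp: emb_def fun_eq_iff)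

lemma exec_set:
  "nval e (emb vs g) = k \<Longrightarrow> exec (NStore (addr c) e) (emb vs g) (emb (vs(c := k)) g)"
  using exec.NStore[of "addr c" e "emb vs g"] by (simp add: emb_upd del: add_2_eq_Suc' add_2_eq_Suc)

lemma exec_RStore:
  "nval a (emb vs g) = k \<Longrightarrow> rval e (emb vs g) = y \<Longrightarrow> exec (RStore a e) (emb vs g) (emb vs (g(k := y)))"
  using exec.RStore[of a e "emb vs g"] by (simp add: emb_def)

text \<open>The bound is evaluated anew in each pass, so its value has to follow from the invariant,
  which is stated with the counter already advanced.\<close>

lemma exec_For:
  assumes init: "I 0 (vs(x := 0)) g"
    and bound: "\<And>i vs g. i \<le> k \<Longrightarrow> I i vs g \<Longrightarrow> vs x = i \<Longrightarrow> nval e (emb vs g) = k"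
    and step: "\<And>i vs g. i < k \<Longrightarrow> I i vs g \<Longrightarrow> vs x = i \<Longrightarrow>
      \<exists>vs' g'. exec body (emb vs g) (emb vs' g') \<and> vs' x = i \<and> I (Suc i) (vs'(x := Suc i)) g'"
  shows "\<exists>vs' g'. exec (For x e body) (emb vs g) (emb vs' g') \<and> vs' x = k \<and> I k vs' g'"
proof -
  let ?W = "While (NLess (V x) e) (Seq body (NStore (addr x) (NAdd (V x) (NConst 1))))"
  have loop: "\<exists>vs' g'. exec ?W (emb vs g) (emb vs' g') \<and> vs' x = k \<and> I k vs' g'"
    if "i \<le> k" "I i vs g" "vs x = i" for i vs g
    using that
  proof (induction "k - i" arbitrary: i vs g)
    case 0
    then have "i = k" by simp
    then have "\<not> bval (NLess (V x) e) (emb vs g)" using 0 bound[of i vs g] by simp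
    from exec.WhileFalse[OF this] show ?case using 0 \<open>i = k\<close> by blast
  next
    case (Suc r)
    then have "i < k" by simp
    then obtain vs1 g1 where 1: "exec body (emb vs g) (emb vs1 g1)" "vs1 x = i"
        "I (Suc i) (vs1(x := Suc i)) g1"
      using step Suc.prems by blast
    have "exec (NStore (addr x) (NAdd (V x) (NConst 1))) (emb vs1 g1) (emb (vs1(x := Suc i)) g1)"
      using 1(2) by (intro exec_set) simp
    with 1(1) have body: "exec (Seq body (NStore (addr x) (NAdd (V x) (NConst 1))))
        (emb vs g) (emb (vs1(x := Suc i)) g1)"
      by (rule exec.Seq)
    have "r = k - Suc i" "Suc i \<le> k" using Suc.hyps(2) by simp_all
    then obtain vs2 g2 where "exec ?W (emb (vs1(x := Suc i)) g1) (emb vs2 g2)" "vs2 x = k" "I k vs2 g2"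
      using Suc.hyps(1)[of "Suc i" "vs1(x := Suc i)" g1] 1(3) by auto
    moreover have "bval (NLess (V x) e) (emb vs g)"
      using bound[of i vs g] Suc.prems \<open>i < k\<close> by simp
    ultimately show ?case using exec.WhileTrue[OF _ body] by blast
  qed
  have "exec (NStore (addr x) (NConst 0)) (emb vs g) (emb (vs(x := 0)) g)"
    by (intro exec_set) simp
  moreover obtain vs' g' where "exec ?W (emb (vs(x := 0)) g) (emb vs' g')" "vs' x = k" "I k vs' g'"
    using loop[of 0 "vs(x := 0)" g] init by auto
  ultimately show ?thesis unfolding For_def using exec.Seq by blast
qed

lemma exec_For_reals:
  assumes "\<And>j h. nval e (emb (vs(x := j)) h) = k"
    and "\<And>j. j < k \<Longrightarrow> exec body (emb (vs(x := j)) (F j)) (emb (vs(x := j)) (F (Suc j)))"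
  shows "exec (For x e body) (emb vs (F 0)) (emb (vs(x := k)) (F k))"
proof -
  have "\<exists>vs' g'. exec (For x e body) (emb vs (F 0)) (emb vs' g') \<and> vs' x = k \<and>
      (vs' = vs(x := k) \<and> g' = F k)"
    by (rule exec_For[where I = "\<lambda>i vs' g'. vs' = vs(x := i) \<and> g' = F i"])
      (use assms in \<open>auto intro!: exI[of _ "vs(x := _)"]\<close>)
  then show ?thesis by auto
qed

lemma exec_For_agree:
  assumes x: "x \<in> S"
    and bound: "\<And>vs' h. agree S vs vs' \<Longrightarrow> nval e (emb vs' h) = k"
    and step: "\<And>j vs'. j < k \<Longrightarrow> agree S vs vs' \<Longrightarrow> vs' x = j \<Longrightarrow>
      \<exists>vs''. exec body (emb vs' (F j)) (emb vs'' (F (Suc j))) \<and> agree S vs' vs'' \<and> vs'' x = j"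
  shows "\<exists>vs'. exec (For x e body) (emb vs (F 0)) (emb vs' (F k)) \<and> agree S vs vs'"
proof -
  have "\<exists>vs' g'. exec (For x e body) (emb vs (F 0)) (emb vs' g') \<and> vs' x = k \<and>
      (agree S vs vs' \<and> g' = F k)"
  proof (rule exec_For[where I = "\<lambda>i vs' g'. agree S vs vs' \<and> g' = F i"])
    fix j vs' g' assume j: "j < k" "agree S vs vs' \<and> g' = F j" "vs' x = j"
    then obtain vs'' where "exec body (emb vs' g') (emb vs'' (F (Suc j)))" "agree S vs' vs''" "vs'' x = j"
      using step[of j vs'] by blast
    moreover have "agree S vs (vs''(x := Suc j))"
      using j(2) \<open>agree S vs' vs''\<close> x by (auto simp: agree_def)
    ultimately show "\<exists>vs'' g''. exec body (emb vs' g') (emb vs'' g'') \<and> vs'' x = j \<and>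
        (agree S vs (vs''(x := Suc j)) \<and> g'' = F (Suc j))" by blast
  qed (use x bound in \<open>auto simp: agree_def\<close>)
  then show ?thesis by blast
qed

lemma exec_Sum:
  assumes e: "\<And>j h. nval e (emb (vs(x := j)) h) = k"
    and dst: "\<And>j h. nval dst (emb (vs(x := j)) h) = a"
    and f: "\<And>j y. j < k \<Longrightarrow> rval f (emb (vs(x := j)) (g(a := y))) = F j"
  shows "exec (Sum dst x e f) (emb vs g) (emb (vs(x := k)) (g(a := \<Sum>j<k. F j)))"
proof -
  have "exec (RStore dst RZero) (emb vs g) (emb vs (g(a := \<Sum>j<(0::nat). F j)))"
    using dst[of "vs x"] by (intro exec_RStore) simp_all
  moreover have "exec (For x e (RStore dst (RAdd (RCell dst) f)))
      (emb vs (g(a := \<Sum>j<0. F j))) (emb (vs(x := k)) (g(a := \<Sum>j<k. F j)))"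
  proof (rule exec_For_reals[where F = "\<lambda>i. g(a := \<Sum>j<i. F j)", OF e])
    fix j assume "j < k"
    have "exec (RStore dst (RAdd (RCell dst) f)) (emb (vs(x := j)) (g(a := \<Sum>j<j. F j)))
        (emb (vs(x := j)) ((g(a := \<Sum>j<j. F j))(a := \<Sum>j<Suc j. F j)))"
      by (intro exec_RStore) (simp_all add: dst f[OF \<open>j < k\<close>])
    then show "exec (RStore dst (RAdd (RCell dst) f)) (emb (vs(x := j)) (g(a := \<Sum>j<j. F j)))
        (emb (vs(x := j)) (g(a := \<Sum>j<Suc j. F j)))" by simp
  qed
  ultimately show ?thesis unfolding Sum_def by (rule exec.Seq)
qed

lemma exec_Pow: "exec Pow (emb vs g) (emb (vs(1 := m ^ vs 0, 2 := vs 0)) g)"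
proof -
  have "exec (NStore (addr 1) (NConst 1)) (emb vs g) (emb (vs(1 := 1)) g)"
    by (intro exec_set) simp
  moreover have "\<exists>vs' g'. exec (For 2 (V 0) (NStore (addr 1) (NMult (V 1) cardE)))
      (emb (vs(1 := 1)) g) (emb vs' g') \<and> vs' 2 = vs 0 \<and> (vs' = vs(1 := m ^ vs 0, 2 := vs 0) \<and> g' = g)"
  proof (rule exec_For[where I = "\<lambda>i vs' g'. vs' = vs(1 := m ^ i, 2 := i) \<and> g' = g"])
    fix i vs' g' assume *: "vs' = vs(1 := m ^ i, 2 := i) \<and> g' = g"
    have st: "exec (NStore (addr 1) (NMult (V 1) cardE)) (emb vs' g')
        (emb (vs'(1 := m ^ Suc i)) g')"
      by (intro exec_set) (simp add: *)
    show "\<exists>vs'' g''. exec (NStore (addr 1) (NMult (V 1) cardE)) (emb vs' g')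
        (emb vs'' g'') \<and> vs'' 2 = i \<and>
        (vs''(2 := Suc i) = vs(1 := m ^ Suc i, 2 := Suc i) \<and> g'' = g)"
      by (rule exI, rule exI, rule conjI, rule st) (use * in \<open>auto simp: fun_eq_iff\<close>)
  qed (auto simp: fun_eq_iff)
  ultimately show ?thesis unfolding Pow_def using exec.Seq by blast
qed

end


section \<open>The program\<close>

text \<open>Variables: 0 is the horizon, 1 a power of the number of delays, 2 and 3 are loop counters, 4 is
  the sending time, 5 the current time, 6 the code of the signal (its digits in base \<open>card D\<close>
  index the delays), 7 the digits not yet read, 8 the delivery time, 9 flags a time at which the
  inputs span, 10 is the answer. The vectors \<open>A\<^sup>k b\<close> up to the horizon are stored from the input cell of
  \<open>b\<close> onwards, followed by the projection matrix, a scratch vector and an accumulator.\<close>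

definition sqE :: nexp where "sqE = NMult dimE dimE"

definition matE :: nexp where "matE = NAdd sqE (NAdd dimE (NMult (V 0) dimE))"

definition vecE :: nexp where "vecE = NAdd matE sqE"

definition accE :: nexp where "accE = NAdd vecE dimE"

text \<open>One counter \<open>k\<close> serves both indices: it produces coordinate
  \<open>k mod n\<close> of power \<open>k div n + 1\<close> from the stored power
  \<open>k div n\<close>.\<close>

definition Table :: prog where
  "Table = For 3 (NMult (V 0) dimE) (Sum (NAdd sqE (NAdd dimE (V 3))) 2 dimE
     (RMult (RCell (NAdd (NMult (NMod (V 3) dimE) dimE) (V 2)))
            (RCell (NAdd sqE (NAdd (NMult (NDiv (V 3) dimE) dimE) (V 2))))))"

definition Unit_Matrix :: prog where
  "Unit_Matrix = For 3 sqE
     (Cond (BAnd (BNot (NLess (NDiv (V 3) dimE) (NMod (V 3) dimE)))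
                 (BNot (NLess (NMod (V 3) dimE) (NDiv (V 3) dimE))))
       (RStore (NAdd matE (V 3)) ROne) (RStore (NAdd matE (V 3)) RZero))"

text \<open>The projected vector and its squared norm are saved before the matrix is overwritten in
  place. A zero norm needs no test, as division by zero yields 0.\<close>

definition Deflate :: prog where
  "Deflate = Seq
     (For 3 dimE (Sum (NAdd vecE (V 3)) 2 dimE
       (RMult (RCell (NAdd matE (NAdd (NMult (V 3) dimE) (V 2))))
              (RCell (NAdd sqE (NAdd (NMult (NSub (V 5) (V 8)) dimE) (V 2)))))))
     (Seq
       (Sum accE 3 dimE (RMult (RCell (NAdd vecE (V 3))) (RCell (NAdd vecE (V 3)))))
       (For 3 sqE (RStore (NAdd matE (V 3)) (RSub (RCell (NAdd matE (V 3)))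
         (RDiv (RMult (RCell (NAdd vecE (NDiv (V 3) dimE))) (RCell (NAdd vecE (NMod (V 3) dimE))))
               (RCell accE))))))"

text \<open>Deliveries after the current time are skipped, since the truncated difference of the
  times would select \<open>b\<close> itself.\<close>

definition Deliver :: prog where
  "Deliver = Seq (NStore (addr 8) (NAdd (V 4) (NCell (NAdd (NMod (V 7) cardE) (NConst 2)))))
     (Seq (NStore (addr 7) (NDiv (V 7) cardE))
       (Cond (NLess (V 5) (V 8)) Skip Deflate))"

text \<open>All delivered vectors age with the current time, so the projection is rebuilt from the
  unit matrix.\<close>

definition Test_Time :: prog where
  "Test_Time = Seq Unit_Matrix (Seq (NStore (addr 7) (V 6))
     (Seq (For 4 (NAdd (V 5) (NConst 1)) Deliver)
       (Seq (Sum accE 2 dimE (RCell (NAdd matE (NAdd (NMult (V 2) dimE) (V 2)))))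
         (Cond (RLess RZero (RCell accE)) Skip (NStore (addr 9) (NConst 1))))))"

definition Test_Code :: prog where
  "Test_Code = Seq (NStore (addr 9) (NConst 0)) (Seq (For 5 (V 0) Test_Time)
     (Cond (NLess (NConst 0) (V 9)) Skip (NStore (addr 10) (NConst 0))))"

definition Bound :: prog where
  "Bound = Seq (NStore (addr 0) (NAdd (NAdd dimE (NCell (NAdd cardE (NConst 1)))) (NConst 1)))
     (Seq (For 3 (NAdd dimE (NConst 1))
        (Seq Pow (NStore (addr 0) (NMult (V 0) (NAdd (V 1) (NConst 2))))))
       (NStore (addr 0) (NMult (NConst 4) (V 0))))"

definition Decide :: prog where
  "Decide = Seq Bound (Seq Table (Seq Pow (Seq (NStore (addr 10) (NConst 1))
     (Seq (For 6 (V 1) Test_Code) (NStore (NConst 0) (V 10))))))"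

lemma cell_less: "i < p \<Longrightarrow> j < n \<Longrightarrow> i * n + j < p * (n::nat)"
proof -
  assume "i < p" "j < n"
  then have "i * n + j < Suc i * n" by simp
  also have "\<dots> \<le> p * n" using \<open>i < p\<close> by (intro mult_right_mono) simp_all
  finally show ?thesis .
qed

section \<open>Memory layout and the matrix routines\<close>

locale search = machine n D + input_orbit n M b
  for n :: nat and D :: "nat set" and M :: "nat \<Rightarrow> nat \<Rightarrow> real" and b :: "nat \<Rightarrow> real" +
  fixes N :: nat
begin

definition base :: nat where
  "base = n * n + (n + N * n)"

lemma nval_sqE [simp]: "nval sqE (emb vs g) = n * n"
  by (simp add: sqE_def)

lemma nval_matE [simp]: "vs 0 = N \<Longrightarrow> nval matE (emb vs g) = base"
  and nval_vecE [simp]: "vs 0 = N \<Longrightarrow> nval vecE (emb vs g) = base + n * n"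
  and nval_accE [simp]: "vs 0 = N \<Longrightarrow> nval accE (emb vs g) = base + n * n + n"
  by (simp_all add: matE_def vecE_def accE_def base_def)

definition input :: "(nat \<Rightarrow> real) \<Rightarrow> bool" where
  "input g \<longleftrightarrow> (\<forall>i<n. \<forall>j<n. g (i * n + j) = M i j) \<and> (\<forall>j<n. g (n * n + j) = b j)"

definition table :: "(nat \<Rightarrow> real) \<Rightarrow> bool" where
  "table g \<longleftrightarrow> (\<forall>q\<le>N. \<forall>j<n. g (n * n + (q * n + j)) = orbit q j)"

definition holds :: "(nat \<Rightarrow> real) \<Rightarrow> (nat \<Rightarrow> nat \<Rightarrow> real) \<Rightarrow> bool" where
  "holds g P \<longleftrightarrow> table g \<and> (\<forall>i<n. \<forall>j<n. g (base + (i * n + j)) = P i j)"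

lemma table_index: "q \<le> N \<Longrightarrow> j < n \<Longrightarrow> n * n + (q * n + j) < base"
  using cell_less[of q "Suc N" j n] by (simp add: base_def)

lemma table_cong: "table g \<Longrightarrow> (\<And>a. a < base \<Longrightarrow> g' a = g a) \<Longrightarrow> table g'"
  by (simp add: table_def table_index)

lemma exec_Table:
  assumes "vs 0 = N" "input g"
  obtains vs' g' where "exec Table (emb vs g) (emb vs' g')" "agree {2, 3} vs vs'" "table g'"
proof -
  define F where "F i = (\<lambda>a. if n * n \<le> a \<and> a < n * n + n + i
      then orbit ((a - n * n) div n) ((a - n * n) mod n) else g a)" for i
  have F0: "F 0 = g"
    using assms(2) by (auto simp: F_def input_def orbit_def fun_eq_iff)
      (metis add_less_cancel_left le_add_diff_inverse)
  have "\<exists>vs'. exec Table (emb vs (F 0)) (emb vs' (F (N * n))) \<and> agree {2, 3} vs vs'"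
    unfolding Table_def
  proof (rule exec_For_agree)
    fix k vs' assume k: "k < N * n" and ag: "agree {2, 3} vs vs'" and v3: "vs' 3 = k"
    have n: "0 < n" using k by (cases n) simp_all
    have v0: "vs' 0 = N" using agreeD[OF ag, of 0] assms(1) by simp
    have "exec (Sum (NAdd sqE (NAdd dimE (V 3))) 2 dimE
       (RMult (RCell (NAdd (NMult (NMod (V 3) dimE) dimE) (V 2)))
            (RCell (NAdd sqE (NAdd (NMult (NDiv (V 3) dimE) dimE) (V 2))))))
        (emb vs' (F k)) (emb (vs'(2 := n))
          ((F k)(n * n + (n + k) := \<Sum>j<n. M (k mod n) j * orbit (k div n) j)))"
    proof (rule exec_Sum)
      fix j y assume j: "j < n"
      have 1: "k mod n * n + j < n * n" using cell_less[of "k mod n" n j n] n j by simp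
      \<comment> \<open>The cells read belong to a power that was completed before cell
        \<open>k\<close> is written.\<close>
      have "k div n * n + j < n + k" using j by (metis add.commute add_mono_thms_linordered_field(4) div_times_less_eq_dividend)
      then show "rval (RMult (RCell (NAdd (NMult (NMod (V 3) dimE) dimE) (V 2)))
            (RCell (NAdd sqE (NAdd (NMult (NDiv (V 3) dimE) dimE) (V 2)))))
            (emb (vs'(2 := j)) ((F k)(n * n + (n + k) := y))) = M (k mod n) j * orbit (k div n) j"
        using 1 j n assms(2) by (simp add: v3 F_def input_def)
    qed (simp_all add: v3)
    moreover have "(F k)(n * n + (n + k) := \<Sum>j<n. M (k mod n) j * orbit (k div n) j) = F (Suc k)"
    proof -
      have "(\<Sum>j<n. M (k mod n) j * orbit (k div n) j) = orbit ((n + k) div n) ((n + k) mod n)"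
        using n by (simp add: orbit_def app_def)
      then show ?thesis by (auto simp: F_def fun_eq_iff less_Suc_eq)
    qed
    ultimately show "\<exists>vs''. exec (Sum (NAdd sqE (NAdd dimE (V 3))) 2 dimE
       (RMult (RCell (NAdd (NMult (NMod (V 3) dimE) dimE) (V 2)))
            (RCell (NAdd sqE (NAdd (NMult (NDiv (V 3) dimE) dimE) (V 2))))))
        (emb vs' (F k)) (emb vs'' (F (Suc k))) \<and> agree {2, 3} vs' vs'' \<and> vs'' 3 = k"
      using v3 by (intro exI[of _ "vs'(2 := n)"]) (simp add: agree_def)
  qed (use assms(1) in \<open>auto simp: agree_def\<close>)
  moreover have "table (F (N * n))"
    unfolding table_def
  proof (intro allI impI)
    fix q j assume "q \<le> N" "j < n"
    then show "F (N * n) (n * n + (q * n + j)) = orbit q j"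
      using table_index[of q j] by (simp add: F_def base_def add.assoc)
  qed
  ultimately show thesis using that by (auto simp: F0)
qed

lemma exec_Unit_Matrix:
  assumes "vs 0 = N" "table g"
  obtains g' where "exec Unit_Matrix (emb vs g) (emb (vs(3 := n * n)) g')"
    "holds g' (\<lambda>i j. if i = j then 1 else 0)"
proof -
  define F where "F i = (\<lambda>a. if base \<le> a \<and> a < base + i
      then (if (a - base) div n = (a - base) mod n then 1 else 0) else g a)" for i
  have "exec Unit_Matrix (emb vs (F 0)) (emb (vs(3 := n * n)) (F (n * n)))"
    unfolding Unit_Matrix_def
  proof (rule exec_For_reals)
    fix k assume "k < n * n"
    have upd: "F (Suc k) = (F k)(base + k := if k div n = k mod n then 1 else 0)"
      by (auto simp: F_def fun_eq_iff less_Suc_eq)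
    show "exec (Cond (BAnd (BNot (NLess (NDiv (V 3) dimE) (NMod (V 3) dimE)))
                 (BNot (NLess (NMod (V 3) dimE) (NDiv (V 3) dimE))))
       (RStore (NAdd matE (V 3)) ROne) (RStore (NAdd matE (V 3)) RZero))
       (emb (vs(3 := k)) (F k)) (emb (vs(3 := k)) (F (Suc k)))"
      unfolding upd using assms(1)
      by (cases "k div n = k mod n") (rule exec.CondTrue exec.CondFalse; force intro!: exec_RStore)+
  qed (use assms(1) in simp)
  moreover have "F 0 = g" by (auto simp: F_def)
  moreover have "holds (F (n * n)) (\<lambda>i j. if i = j then 1 else 0)"
    unfolding holds_def
  proof (intro conjI allI impI)
    show "table (F (n * n))" using assms(2) by (rule table_cong) (simp add: F_def)
    fix i j assume "i < n" "j < n"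
    then show "F (n * n) (base + (i * n + j)) = (if i = j then 1 else 0)"
      using cell_less[of i n j n] by (simp add: F_def)
  qed
  ultimately show thesis using that by simp
qed

lemma exec_Deflate:
  assumes vs: "vs 0 = N" "vs 5 - vs 8 = q" and q: "q \<le> N" and g: "holds g P"
  obtains vs' g' where "exec Deflate (emb vs g) (emb vs' g')" "agree {2, 3} vs vs'"
    "holds g' (deflate n P (orbit q))"
proof -
  define u where "u = app n P (orbit q)"
  define U where "U = base + n * n"
  define s where "s = dot n u u"
  define G where "G i = (\<lambda>a. if U \<le> a \<and> a < U + i then u (a - U) else g a)" for i
  have "\<exists>vs'. exec (For 3 dimE (Sum (NAdd vecE (V 3)) 2 dimE
       (RMult (RCell (NAdd matE (NAdd (NMult (V 3) dimE) (V 2))))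
              (RCell (NAdd sqE (NAdd (NMult (NSub (V 5) (V 8)) dimE) (V 2)))))))
      (emb vs (G 0)) (emb vs' (G n)) \<and> agree {2, 3} vs vs'"
  proof (rule exec_For_agree)
    fix k vs' assume k: "k < n" and ag: "agree {2, 3} vs vs'" and v3: "vs' 3 = k"
    have v: "vs' 0 = N" "vs' 5 - vs' 8 = q"
      using agreeD[OF ag, of 0] agreeD[OF ag, of 5] agreeD[OF ag, of 8] vs by simp_all
    have "exec (Sum (NAdd vecE (V 3)) 2 dimE
       (RMult (RCell (NAdd matE (NAdd (NMult (V 3) dimE) (V 2))))
              (RCell (NAdd sqE (NAdd (NMult (NSub (V 5) (V 8)) dimE) (V 2))))))
       (emb vs' (G k)) (emb (vs'(2 := n)) ((G k)(U + k := \<Sum>j<n. P k j * orbit q j)))"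
    proof (rule exec_Sum)
      fix j y assume j: "j < n"
      have 1: "base + (k * n + j) < U" using cell_less[OF k j] by (simp add: U_def)
      have 2: "n * n + (q * n + j) < U" using table_index[OF q j] by (simp add: U_def)
      show "rval (RMult (RCell (NAdd matE (NAdd (NMult (V 3) dimE) (V 2))))
              (RCell (NAdd sqE (NAdd (NMult (NSub (V 5) (V 8)) dimE) (V 2)))))
          (emb (vs'(2 := j)) ((G k)(U + k := y))) = P k j * orbit q j"
        using 1 2 g j k q by (simp add: v v3 G_def holds_def table_def)
    qed (simp_all add: v v3 U_def)
    moreover have "(G k)(U + k := \<Sum>j<n. P k j * orbit q j) = G (Suc k)"
      by (auto simp: G_def fun_eq_iff less_Suc_eq u_def app_def)
    ultimately show "\<exists>vs''. exec (Sum (NAdd vecE (V 3)) 2 dimE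
       (RMult (RCell (NAdd matE (NAdd (NMult (V 3) dimE) (V 2))))
              (RCell (NAdd sqE (NAdd (NMult (NSub (V 5) (V 8)) dimE) (V 2))))))
        (emb vs' (G k)) (emb vs'' (G (Suc k))) \<and> agree {2, 3} vs' vs'' \<and> vs'' 3 = k"
      using v3 by (intro exI[of _ "vs'(2 := n)"]) (simp add: agree_def)
  qed (simp_all add: agree_def)
  then obtain vs1 where 1: "exec (For 3 dimE (Sum (NAdd vecE (V 3)) 2 dimE
       (RMult (RCell (NAdd matE (NAdd (NMult (V 3) dimE) (V 2))))
              (RCell (NAdd sqE (NAdd (NMult (NSub (V 5) (V 8)) dimE) (V 2)))))))
      (emb vs (G 0)) (emb vs1 (G n))" and ag: "agree {2, 3} vs vs1" by blast
  have v0: "vs1 0 = N" using agreeD[OF ag, of 0] vs by simp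
  define g2 where "g2 = (G n)(U + n := s)"
  have 2: "exec (Sum accE 3 dimE (RMult (RCell (NAdd vecE (V 3))) (RCell (NAdd vecE (V 3)))))
      (emb vs1 (G n)) (emb (vs1(3 := n)) g2)"
    unfolding g2_def s_def dot_def
    by (rule exec_Sum) (simp_all add: v0 U_def G_def)
  \<comment> \<open>Only matrix cells change, each from its own old value, so the saved vector and
    norm stay valid during the update.\<close>
  define H where "H i = (\<lambda>a. if base \<le> a \<and> a < base + i
      then deflate n P (orbit q) ((a - base) div n) ((a - base) mod n) else g2 a)" for i
  have 3: "exec (For 3 sqE (RStore (NAdd matE (V 3)) (RSub (RCell (NAdd matE (V 3)))
         (RDiv (RMult (RCell (NAdd vecE (NDiv (V 3) dimE))) (RCell (NAdd vecE (NMod (V 3) dimE))))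
               (RCell accE)))))
      (emb (vs1(3 := n)) (H 0)) (emb (vs1(3 := n, 3 := n * n)) (H (n * n)))"
  proof (rule exec_For_reals)
    fix k assume k: "k < n * n"
    then have n: "0 < n" by (cases n) simp_all
    have kd: "k div n < n" "k mod n < n" using k n by (simp_all add: less_mult_imp_div_less)
    have "g (base + (k div n * n + k mod n)) = P (k div n) (k mod n)"
      using g kd unfolding holds_def by blast
    then have P: "g (base + k) = P (k div n) (k mod n)" by simp
    have upd: "H (Suc k) = (H k)(base + k := deflate n P (orbit q) (k div n) (k mod n))"
      by (auto simp: H_def fun_eq_iff less_Suc_eq)
    have "H k (base + k) = P (k div n) (k mod n)"
      using P k by (simp add: H_def g2_def G_def U_def)
    moreover have "H k (U + i) = u i" if "i < n" for i
      using that k by (simp add: H_def g2_def G_def U_def)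
    moreover have "H k (U + n) = s"
      using k by (simp add: H_def g2_def U_def)
    ultimately show "exec (RStore (NAdd matE (V 3)) (RSub (RCell (NAdd matE (V 3)))
         (RDiv (RMult (RCell (NAdd vecE (NDiv (V 3) dimE))) (RCell (NAdd vecE (NMod (V 3) dimE))))
               (RCell accE))))
       (emb (vs1(3 := n, 3 := k)) (H k)) (emb (vs1(3 := n, 3 := k)) (H (Suc k)))"
      unfolding upd using kd
      by (intro exec_RStore) (simp_all add: v0 deflate_def s_def u_def flip: U_def)
  qed (simp add: v0)
  have "G 0 = g" "H 0 = g2" by (auto simp: G_def H_def)
  then have "exec Deflate (emb vs g) (emb (vs1(3 := n * n)) (H (n * n)))"
    unfolding Deflate_def using 1 2 3 by (auto intro: exec.Seq)
  moreover have "agree {2, 3} vs (vs1(3 := n * n))" using ag by (auto simp: agree_def)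
  moreover have "holds (H (n * n)) (deflate n P (orbit q))"
    unfolding holds_def
  proof (intro conjI allI impI)
    have "table g" using g by (simp add: holds_def)
    then show "table (H (n * n))"
      by (rule table_cong) (simp add: H_def g2_def G_def U_def)
    fix i j assume "i < n" "j < n"
    then show "H (n * n) (base + (i * n + j)) = deflate n P (orbit q) i j"
      using cell_less[of i n j n] by (simp add: H_def)
  qed
  ultimately show thesis using that by blast
qed

end


section \<open>Signals as numbers in base \<open>card D\<close>\<close>

context machine
begin

definition signal :: "nat \<Rightarrow> nat \<Rightarrow> nat" where
  "signal code t = delay (code div m ^ t mod m)"

lemma delay_in: "k < m \<Longrightarrow> delay k \<in> D"
  using finite_D nth_mem[of k "sorted_list_of_set D"] by (simp add: delay_def)

lemma delay_surj: "e \<in> D \<Longrightarrow> \<exists>k<m. delay k = e"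
  using finite_D in_set_conv_nth[of e "sorted_list_of_set D"] by (simp add: delay_def)

text \<open>The first delay is the least significant digit, so dividing the code by the base shifts
  the signal by one step.\<close>

lemma signal_surj:
  assumes "\<And>t. t < N \<Longrightarrow> \<sigma> t \<in> D"
  shows "\<exists>code<m ^ N. \<forall>t<N. signal code t = \<sigma> t"
  using assms
proof (induction N arbitrary: \<sigma>)
  case (Suc N)
  obtain c where c: "c < m ^ N" "\<And>t. t < N \<Longrightarrow> signal c t = \<sigma> (Suc t)"
    using Suc.IH[of "\<lambda>t. \<sigma> (Suc t)"] Suc.prems by auto
  obtain k where k: "k < m" "delay k = \<sigma> 0" using delay_surj Suc.prems[of 0] by auto
  have "c * m + k < m ^ Suc N" using cell_less[OF c(1) k(1)] by (simp add: mult.commute)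
  moreover have "signal (c * m + k) t = \<sigma> t" if "t < Suc N" for t
  proof (cases t)
    case 0 then show ?thesis using k by (simp add: signal_def)
  next
    case (Suc t')
    have "(c * m + k) div m ^ Suc t' = c div m ^ t'"
      using k(1) by (simp add: div_mult2_eq)
    then show ?thesis using c(2)[of t'] that by (simp add: Suc signal_def)
  qed
  ultimately show ?case by blast
qed simp

text \<open>The delays are stored in increasing order from cell 2, so cell \<open>m + 1\<close>
  holds the largest one. Without delays this is cell 1, which holds
  \<open>card D = 0\<close>.\<close>

definition last_delay :: nat where
  "last_delay = (if m = 0 then 0 else delay (m - 1))"

lemma nval_last_delay: "nval (NCell (NAdd cardE (NConst 1))) (emb vs g) = last_delay"
  by (simp add: last_delay_def) (simp add: emb_def)

lemma le_last_delay: "e \<in> D \<Longrightarrow> e \<le> last_delay"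
proof -
  assume "e \<in> D"
  then obtain k where k: "k < m" "delay k = e" using delay_surj by blast
  then show ?thesis
    using sorted_nth_mono[OF sorted_sorted_list_of_set[of D], of k "m - 1"]
    by (auto simp: last_delay_def delay_def)
qed

lemma exec_Bound:
  "\<exists>vs'. exec Bound (emb vs g) (emb vs' g) \<and> vs' 0 = 4 * grow m (n + last_delay + 1) (Suc n)"
proof -
  define G where "G = grow m (n + last_delay + 1)"
  have 1: "exec (NStore (addr 0) (NAdd (NAdd dimE (NCell (NAdd cardE (NConst 1)))) (NConst 1)))
      (emb vs g) (emb (vs(0 := G 0)) g)"
    by (intro exec_set)
      (simp only: nval.simps(1,3) nval_dim, simp only: nval_last_delay G_def grow.simps)
  have "\<exists>vs' g'. exec (For 3 (NAdd dimE (NConst 1))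
        (Seq Pow (NStore (addr 0) (NMult (V 0) (NAdd (V 1) (NConst 2))))))
        (emb (vs(0 := G 0)) g) (emb vs' g') \<and> vs' 3 = Suc n \<and> (vs' 0 = G (Suc n) \<and> g' = g)"
  proof (rule exec_For[where I = "\<lambda>i vs' g'. vs' 0 = G i \<and> g' = g"])
    fix i :: nat and vs' :: "nat \<Rightarrow> nat" and g' assume *: "vs' 0 = G i \<and> g' = g" "vs' 3 = i"
    let ?vs = "vs'(1 := m ^ G i, 2 := G i)"
    have "exec Pow (emb vs' g) (emb ?vs g)" using exec_Pow[of vs' g] * by simp
    moreover have "exec (NStore (addr 0) (NMult (V 0) (NAdd (V 1) (NConst 2))))
        (emb ?vs g) (emb (?vs(0 := G (Suc i))) g)"
      by (intro exec_set) (simp add: * G_def)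
    ultimately have "exec (Seq Pow (NStore (addr 0) (NMult (V 0) (NAdd (V 1) (NConst 2)))))
        (emb vs' g) (emb (?vs(0 := G (Suc i))) g)" by (rule exec.Seq)
    then show "\<exists>vs'' g''. exec (Seq Pow (NStore (addr 0) (NMult (V 0) (NAdd (V 1) (NConst 2)))))
        (emb vs' g') (emb vs'' g'') \<and> vs'' 3 = i \<and> ((vs''(3 := Suc i)) 0 = G (Suc i) \<and> g'' = g)"
      by (rule_tac x = "?vs(0 := G (Suc i))" in exI, rule_tac x = g in exI) (simp add: *)
  qed simp_all
  then obtain vs2 where 2: "exec (For 3 (NAdd dimE (NConst 1))
        (Seq Pow (NStore (addr 0) (NMult (V 0) (NAdd (V 1) (NConst 2))))))
        (emb (vs(0 := G 0)) g) (emb vs2 g)" "vs2 0 = G (Suc n)" by blast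
  have 3: "exec (NStore (addr 0) (NMult (NConst 4) (V 0))) (emb vs2 g)
      (emb (vs2(0 := 4 * G (Suc n))) g)"
    by (intro exec_set) (simp add: 2(2))
  have "exec Bound (emb vs g) (emb (vs2(0 := 4 * G (Suc n))) g)"
    unfolding Bound_def using 1 2(1) 3 by (intro exec.Seq)
  then show ?thesis
    unfolding G_def by (intro exI[of _ "vs2(0 := 4 * grow m (n + last_delay + 1) (Suc n))"]) simp
qed

end

context search
begin

definition deficient :: "nat \<Rightarrow> nat \<Rightarrow> bool" where
  "deficient code T \<longleftrightarrow> 0 < trace n (proj n (delivered (signal code) (Suc T)) (Suc T))"

lemma exec_Deliver:
  assumes vs: "vs 0 = N" "vs 4 = t" "vs 5 = T" "vs 7 = code div m ^ t"
    and T: "T \<le> N" and m: "0 < m"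
    and g: "holds g (proj n (delivered (signal code) (Suc T)) t)"
  shows "\<exists>vs' g'. exec Deliver (emb vs g) (emb vs' g') \<and> agree {2, 3, 7, 8} vs vs' \<and>
    vs' 7 = code div m ^ Suc t \<and> holds g' (proj n (delivered (signal code) (Suc T)) (Suc t))"
proof -
  define s where "s = t + signal code t"
  define vs1 where "vs1 = vs(8 := s)"
  define vs2 where "vs2 = vs1(7 := code div m ^ Suc t)"
  have "nval (NCell (NAdd (NMod (V 7) cardE) (NConst 2))) (emb vs g) = signal code t"
    unfolding signal_def using m by (intro nval_delay) (simp_all add: vs)
  then have "exec (NStore (addr 8) (NAdd (V 4) (NCell (NAdd (NMod (V 7) cardE) (NConst 2)))))
      (emb vs g) (emb vs1 g)"
    unfolding vs1_def by (intro exec_set) (simp add: vs s_def del: nval.simps(2))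
  moreover have "exec (NStore (addr 7) (NDiv (V 7) cardE)) (emb vs1 g) (emb vs2 g)"
    unfolding vs2_def
    by (intro exec_set) (simp add: vs1_def vs power_Suc2 div_mult2_eq del: power_Suc)
  moreover have "\<exists>vs' g'. exec (Cond (NLess (V 5) (V 8)) Skip Deflate) (emb vs2 g) (emb vs' g') \<and>
      agree {2, 3} vs2 vs' \<and> holds g' (proj n (delivered (signal code) (Suc T)) (Suc t))"
  proof (cases "T < s")
    case True
    then have "exec (Cond (NLess (V 5) (V 8)) Skip Deflate) (emb vs2 g) (emb vs2 g)"
      by (intro exec.CondTrue exec.Skip) (simp add: vs2_def vs1_def vs)
    \<comment> \<open>Deflating by the zero vector changes nothing, so \<open>proj\<close> advances
      although the program does nothing.\<close>
    moreover have "delivered (signal code) (Suc T) t = (\<lambda>_. 0)"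
      using True by (simp add: delivered_def s_def)
    ultimately show ?thesis using g by (auto simp: agree_def deflate_zero)
  next
    case False
    have "vs2 0 = N" "vs2 5 - vs2 8 = T - s" by (simp_all add: vs2_def vs1_def vs)
    then obtain vs3 g3 where "exec Deflate (emb vs2 g) (emb vs3 g3)" "agree {2, 3} vs2 vs3"
        "holds g3 (deflate n (proj n (delivered (signal code) (Suc T)) t) (orbit (T - s)))"
      using exec_Deflate[of vs2 "T - s" g] T g by (metis diff_le_self le_trans)
    moreover have "\<not> bval (NLess (V 5) (V 8)) (emb vs2 g)"
      using False by (simp add: vs2_def vs1_def vs)
    moreover have "delivered (signal code) (Suc T) t = orbit (T - s)"
      using False by (simp add: delivered_def s_def)
    ultimately show ?thesis using exec.CondFalse by fastforce
  qed
  then obtain vs3 g3 where "exec (Cond (NLess (V 5) (V 8)) Skip Deflate) (emb vs2 g) (emb vs3 g3)"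
      and 3: "agree {2, 3} vs2 vs3" "holds g3 (proj n (delivered (signal code) (Suc T)) (Suc t))"
    by blast
  ultimately have "exec Deliver (emb vs g) (emb vs3 g3)"
    unfolding Deliver_def by (intro exec.Seq)
  moreover have "agree {2, 3, 7, 8} vs vs3" "vs3 7 = code div m ^ Suc t"
    using 3(1) by (auto simp: agree_def vs2_def vs1_def)
  ultimately show ?thesis using 3(2) by blast
qed

lemma exec_Test_Time:
  assumes vs: "vs 0 = N" "vs 5 = T" "vs 6 = code" and T: "T \<le> N" and m: "0 < m" and g: "table g"
  shows "\<exists>vs' g'. exec Test_Time (emb vs g) (emb vs' g') \<and> agree {2, 3, 4, 7, 8, 9} vs vs' \<and>
    table g' \<and> vs' 9 = (if deficient code T then vs 9 else 1)"
proof -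
  let ?S = "{2, 3, 4, 7, 8}"
  let ?P = "proj n (delivered (signal code) (Suc T))"
  obtain g1 where 1: "exec Unit_Matrix (emb vs g) (emb (vs(3 := n * n)) g1)" "holds g1 (?P 0)"
    using exec_Unit_Matrix[of vs g] vs(1) g by auto
  define vs2 where "vs2 = vs(3 := n * n, 7 := code)"
  have 2: "exec (NStore (addr 7) (V 6)) (emb (vs(3 := n * n)) g1) (emb vs2 g1)"
    unfolding vs2_def by (intro exec_set) (simp add: vs)
  have "\<exists>vs' g'. exec (For 4 (NAdd (V 5) (NConst 1)) Deliver) (emb vs2 g1) (emb vs' g') \<and>
      vs' 4 = Suc T \<and> (agree ?S vs vs' \<and> vs' 7 = code div m ^ Suc T \<and> holds g' (?P (Suc T)))"
  proof (rule exec_For[where I = "\<lambda>t vs' g'. agree ?S vs vs' \<and> vs' 7 = code div m ^ t \<and> holds g' (?P t)"])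
    fix t vs' g'
    assume t: "t < Suc T" "agree ?S vs vs' \<and> vs' 7 = code div m ^ t \<and> holds g' (?P t)" "vs' 4 = t"
    have "vs' 0 = N" "vs' 5 = T" using t(2) vs by (simp_all add: agree_def)
    then obtain vs'' g'' where *: "exec Deliver (emb vs' g') (emb vs'' g'')"
        "agree {2, 3, 7, 8} vs' vs''" "vs'' 7 = code div m ^ Suc t" "holds g'' (?P (Suc t))"
      using exec_Deliver[of vs' t T code g'] t T m by metis
    have "vs'' 4 = t" using *(2) t(3) by (simp add: agree_def)
    moreover have "agree ?S vs (vs''(4 := Suc t))" using *(2) t(2) by (auto simp: agree_def)
    ultimately show "\<exists>vs'' g''. exec Deliver (emb vs' g') (emb vs'' g'') \<and> vs'' 4 = t \<and>
        (agree ?S vs (vs''(4 := Suc t)) \<and> (vs''(4 := Suc t)) 7 = code div m ^ Suc t \<and>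
          holds g'' (?P (Suc t)))"
      using *(1,3,4) by auto
  qed (use 1(2) vs in \<open>auto simp: agree_def vs2_def\<close>)
  then obtain vs3 g3 where 3: "exec (For 4 (NAdd (V 5) (NConst 1)) Deliver) (emb vs2 g1) (emb vs3 g3)"
      and ag: "agree ?S vs vs3" and g3: "holds g3 (?P (Suc T))" by blast
  have v0: "vs3 0 = N" using ag vs by (simp add: agree_def)
  define vs4 where "vs4 = vs3(2 := n)"
  define g4 where "g4 = g3(base + n * n + n := trace n (?P (Suc T)))"
  have 4: "exec (Sum accE 2 dimE (RCell (NAdd matE (NAdd (NMult (V 2) dimE) (V 2)))))
      (emb vs3 g3) (emb vs4 g4)"
    unfolding vs4_def g4_def trace_def
  proof (rule exec_Sum)
    fix j y assume j: "j < n"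
    have "base + (j * n + j) < base + n * n + n" using cell_less[OF j j] by simp
    then show "rval (RCell (NAdd matE (NAdd (NMult (V 2) dimE) (V 2))))
        (emb (vs3(2 := j)) (g3(base + n * n + n := y))) = ?P (Suc T) j j"
      using g3 j v0 by (simp add: holds_def del: proj.simps)
  qed (simp_all add: v0)
  define vs5 where "vs5 = (if deficient code T then vs4 else vs4(9 := 1))"
  have acc: "rval (RCell accE) (emb vs4 g4) = trace n (?P (Suc T))"
    by (simp add: vs4_def v0 g4_def del: proj.simps)
  have 5: "exec (Cond (RLess RZero (RCell accE)) Skip (NStore (addr 9) (NConst 1)))
      (emb vs4 g4) (emb vs5 g4)"
  proof (cases "deficient code T")
    case True
    then have "bval (RLess RZero (RCell accE)) (emb vs4 g4)"
      using acc by (simp add: deficient_def del: proj.simps rval.simps(3))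
    then show ?thesis using True by (auto simp: vs5_def intro: exec.CondTrue exec.Skip)
  next
    case False
    then have "\<not> bval (RLess RZero (RCell accE)) (emb vs4 g4)"
      using acc by (simp add: deficient_def del: proj.simps rval.simps(3))
    then show ?thesis using False by (auto simp: vs5_def intro!: exec.CondFalse exec_set)
  qed
  have "exec Test_Time (emb vs g) (emb vs5 g4)"
    unfolding Test_Time_def using 1(1) 2 3 4 5 by (intro exec.Seq)
  moreover have "agree {2, 3, 4, 7, 8, 9} vs vs5" using ag by (auto simp: agree_def vs5_def vs4_def)
  moreover have "table g4"
    using g3 unfolding holds_def g4_def by (auto intro: table_cong)
  moreover have "vs5 9 = (if deficient code T then vs 9 else 1)"
    using ag by (simp add: vs5_def vs4_def agree_def)
  ultimately show ?thesis by blast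
qed

lemma exec_Test_Code:
  assumes vs: "vs 0 = N" "vs 6 = code" and m: "0 < m" and g: "table g"
  shows "\<exists>vs' g'. exec Test_Code (emb vs g) (emb vs' g') \<and> agree {2, 3, 4, 5, 7, 8, 9, 10} vs vs' \<and>
    table g' \<and> vs' 10 = (if \<forall>T<N. deficient code T then 0 else vs 10)"
proof -
  let ?S = "{2, 3, 4, 5, 7, 8, 9}"
  let ?I = "\<lambda>T vs' g'. agree ?S vs vs' \<and> table g' \<and>
    vs' 9 = (if \<forall>T'<T. deficient code T' then 0 else Suc 0)"
  have 1: "exec (NStore (addr 9) (NConst 0)) (emb vs g) (emb (vs(9 := 0)) g)"
    by (intro exec_set) simp
  have "\<exists>vs' g'. exec (For 5 (V 0) Test_Time) (emb (vs(9 := 0)) g) (emb vs' g') \<and> vs' 5 = N \<and> ?I N vs' g'"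
  proof (rule exec_For[where I = ?I])
    fix T vs' g' assume T: "T < N" "?I T vs' g'" "vs' 5 = T"
    have "vs' 0 = N" "vs' 6 = code" using T(2) vs by (simp_all add: agree_def)
    then obtain vs'' g'' where *: "exec Test_Time (emb vs' g') (emb vs'' g'')"
        "agree {2, 3, 4, 7, 8, 9} vs' vs''" "table g''"
        "vs'' 9 = (if deficient code T then vs' 9 else 1)"
      using exec_Test_Time[of vs' T code g'] T m by auto
    have "vs'' 5 = T" using *(2) T(3) by (simp add: agree_def)
    moreover have "agree ?S vs (vs''(5 := Suc T))" using *(2) T(2) by (auto simp: agree_def)
    moreover have "vs'' 9 = (if \<forall>T'<Suc T. deficient code T' then 0 else Suc 0)"
      using *(4) T(2) by (auto simp: less_Suc_eq)
    ultimately show "\<exists>vs'' g''. exec Test_Time (emb vs' g') (emb vs'' g'') \<and> vs'' 5 = T \<and>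
        ?I (Suc T) (vs''(5 := Suc T)) g''"
      using *(1,3) by (rule_tac x = vs'' in exI, rule_tac x = g'' in exI) simp
  qed (use vs g in \<open>auto simp: agree_def\<close>)
  then obtain vs2 g2 where 2: "exec (For 5 (V 0) Test_Time) (emb (vs(9 := 0)) g) (emb vs2 g2)"
      and I: "?I N vs2 g2" by blast
  define vs3 where "vs3 = (if \<forall>T<N. deficient code T then vs2(10 := 0) else vs2)"
  have 3: "exec (Cond (NLess (NConst 0) (V 9)) Skip (NStore (addr 10) (NConst 0)))
      (emb vs2 g2) (emb vs3 g2)"
  proof (cases "\<forall>T<N. deficient code T")
    case True
    then have "\<not> bval (NLess (NConst 0) (V 9)) (emb vs2 g2)" using I by simp
    then show ?thesis using True by (auto simp: vs3_def intro!: exec.CondFalse exec_set)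
  next
    case False
    then have "bval (NLess (NConst 0) (V 9)) (emb vs2 g2)" using I by simp
    moreover have "vs3 = vs2" using False unfolding vs3_def by (rule if_not_P)
    ultimately show ?thesis by (simp add: exec.CondTrue exec.Skip)
  qed
  have "exec Test_Code (emb vs g) (emb vs3 g2)"
    unfolding Test_Code_def using 1 2 3 by (intro exec.Seq)
  moreover have "agree {2, 3, 4, 5, 7, 8, 9, 10} vs vs3" using I by (auto simp: agree_def vs3_def)
  moreover have "vs3 10 = (if \<forall>T<N. deficient code T then 0 else vs 10)"
    using I by (auto simp: vs3_def agree_def)
  ultimately show ?thesis using I by blast
qed

lemma exec_Decide:
  assumes N: "N = 4 * grow m (n + last_delay + 1) (Suc n)" and g: "input g"
  shows "\<exists>s. exec Decide (emb vs g) s \<and>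
    fst s 0 = (if \<exists>code<m ^ N. \<forall>T<N. deficient code T then 0 else 1)"
proof -
  \<comment> \<open>Without delays a positive \<open>N\<close> makes \<open>m ^ N\<close> zero, so
    that no code is tried; \<open>0 ^ 0\<close> would be 1.\<close>
  have "0 < N" using grow_ge[of "n + last_delay + 1" m "Suc n"] by (simp add: N del: grow.simps)
  obtain vs1 where 1: "exec Bound (emb vs g) (emb vs1 g)" "vs1 0 = N"
    using exec_Bound[of vs g] by (auto simp: N)
  obtain vs2 g2 where 2: "exec Table (emb vs1 g) (emb vs2 g2)" "agree {2, 3} vs1 vs2" "table g2"
    using exec_Table[of vs1 g] 1(2) g by blast
  define vs3 where "vs3 = vs2(1 := m ^ N, 2 := N)"
  have 3: "exec Pow (emb vs2 g2) (emb vs3 g2)"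
    using exec_Pow[of vs2 g2] 1(2) 2(2) by (simp add: vs3_def agree_def)
  have 4: "exec (NStore (addr 10) (NConst 1)) (emb vs3 g2) (emb (vs3(10 := 1)) g2)"
    by (intro exec_set) simp
  let ?I = "\<lambda>i vs' g'. vs' 0 = N \<and> vs' 1 = m ^ N \<and> table g' \<and>
    vs' 10 = (if \<exists>code<i. \<forall>T<N. deficient code T then 0 else Suc 0)"
  have "\<exists>vs' g'. exec (For 6 (V 1) Test_Code) (emb (vs3(10 := 1)) g2) (emb vs' g') \<and>
      vs' 6 = m ^ N \<and> ?I (m ^ N) vs' g'"
  proof (rule exec_For[where I = ?I])
    show "?I 0 ((vs3(10 := 1))(6 := 0)) g2"
      using 1(2) 2(2,3) by (simp add: vs3_def agree_def)
    fix code :: nat and vs' :: "nat \<Rightarrow> nat" and g' assume c: "code < m ^ N" "?I code vs' g'" "vs' 6 = code"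
    have "0 < m" using c(1) \<open>0 < N\<close> by (cases "m = 0") (simp_all add: zero_power)
    then obtain vs'' g'' where *: "exec Test_Code (emb vs' g') (emb vs'' g'')"
        "agree {2, 3, 4, 5, 7, 8, 9, 10} vs' vs''" "table g''"
        "vs'' 10 = (if \<forall>T<N. deficient code T then 0 else vs' 10)"
      using exec_Test_Code[of vs' code g'] c by auto
    have "vs'' 0 = N" "vs'' 1 = m ^ N" "vs'' 6 = code" using *(2) c by (simp_all add: agree_def)
    moreover have "vs'' 10 = (if \<exists>code'<Suc code. \<forall>T<N. deficient code' T then 0 else Suc 0)"
      unfolding *(4) using c(2) by (auto simp: less_Suc_eq)
    ultimately show "\<exists>vs'' g''. exec Test_Code (emb vs' g') (emb vs'' g'') \<and> vs'' 6 = code \<and>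
        ?I (Suc code) (vs''(6 := Suc code)) g''"
      using *(1,3) by (rule_tac x = vs'' in exI, rule_tac x = g'' in exI) simp
  qed simp
  then obtain vs5 g5 where 5: "exec (For 6 (V 1) Test_Code) (emb (vs3(10 := 1)) g2) (emb vs5 g5)"
      and I: "?I (m ^ N) vs5 g5" by blast
  \<comment> \<open>The answer overwrites the dimension, so the final state is not described by
    \<open>emb\<close>.\<close>
  define s where "s = ((fst (emb vs5 g5))(0 := vs5 10), g5)"
  have 6: "exec (NStore (NConst 0) (V 10)) (emb vs5 g5) s"
    using exec.NStore[of "NConst 0" "V 10" "emb vs5 g5"] by (simp add: s_def)
  have "exec Decide (emb vs g) s"
    unfolding Decide_def using 1(1) 2(1) 3 4 5 6 by (intro exec.Seq)
  moreover have "fst s 0 = (if \<exists>code<m ^ N. \<forall>T<N. deficient code T then 0 else 1)"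
    using I by (simp add: s_def)
  ultimately show ?thesis by blast
qed

lemma deficient_code_iff:
  assumes "0 < N"
  shows "(\<exists>code<m ^ N. \<forall>T<N. deficient code T) \<longleftrightarrow>
    (\<exists>\<sigma>. (\<forall>t<N. \<sigma> t \<in> D) \<and> (\<forall>T<N. 0 < trace n (proj n (delivered \<sigma> (Suc T)) (Suc T))))"
proof
  assume "\<exists>code<m ^ N. \<forall>T<N. deficient code T"
  then obtain code where code: "code < m ^ N" "\<forall>T<N. deficient code T" by blast
  then have "0 < m" using assms by (cases "m = 0") (simp_all add: zero_power)
  then have "signal code t \<in> D" for t by (simp add: signal_def delay_in)
  then show "\<exists>\<sigma>. (\<forall>t<N. \<sigma> t \<in> D) \<and> (\<forall>T<N. 0 < trace n (proj n (delivered \<sigma> (Suc T)) (Suc T)))"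
    using code(2) unfolding deficient_def by blast
next
  assume "\<exists>\<sigma>. (\<forall>t<N. \<sigma> t \<in> D) \<and> (\<forall>T<N. 0 < trace n (proj n (delivered \<sigma> (Suc T)) (Suc T)))"
  then obtain \<sigma> where \<sigma>: "\<And>t. t < N \<Longrightarrow> \<sigma> t \<in> D"
    "\<And>T. T < N \<Longrightarrow> 0 < trace n (proj n (delivered \<sigma> (Suc T)) (Suc T))" by blast
  obtain code where code: "code < m ^ N" "\<And>t. t < N \<Longrightarrow> signal code t = \<sigma> t"
    using signal_surj[of N \<sigma>] \<sigma>(1) by blast
  have "deficient code T" if "T < N" for T
  proof -
    \<comment> \<open>The test at \<open>T\<close> reads only the delays of inputs sent up to
      \<open>T\<close>, where code and signal agree.\<close>
    have "proj n (delivered (signal code) (Suc T)) (Suc T) = proj n (delivered \<sigma> (Suc T)) (Suc T)"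
      using code(2) that by (intro proj_cong) (simp add: delivered_def)
    then show ?thesis using \<sigma>(2)[OF that] unfolding deficient_def by simp
  qed
  then show "\<exists>code<m ^ N. \<forall>T<N. deficient code T" using code(1) by blast
qed

end

section \<open>Correctness of the decision program\<close>

lemma Decide_correct:
  assumes A: "A \<in> carrier_mat n n" and b: "b \<in> carrier_vec n" and D: "finite D"
  shows "halts_with_answer Decide (input_state n A b D) (controllable A b D)"
proof -
  interpret machine n D using D by unfold_locales
  define N where "N = 4 * grow (card D) (n + last_delay + 1) (Suc n)"
  interpret search n D "\<lambda>i j. A $$ (i, j)" "\<lambda>i. b $ i" N by unfold_locales
  have "0 < N" using grow_ge[of "n + last_delay + 1" "card D" "Suc n"] by (simp add: N_def del: grow.simps)
  let ?g = "snd (input_state n A b D)"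
  have "input ?g"
    unfolding input_def
  proof (intro conjI allI impI)
    fix i j assume "i < n" "j < n"
    then show "?g (i * n + j) = A $$ (i, j)"
      using cell_less[of i n j n] by (simp add: input_state_def)
  qed (simp add: input_state_def)
  then obtain s where s: "exec Decide (input_state n A b D) s"
      "fst s 0 = (if \<exists>code<card D ^ N. \<forall>T<N. deficient code T then 0 else 1)"
    using exec_Decide[of ?g "\<lambda>_. 0"] by (auto simp: N_def simp flip: input_state_emb)
  moreover have "controllable A b D \<longleftrightarrow> \<not> (\<exists>code<card D ^ N. \<forall>T<N. deficient code T)"
    unfolding deficient_code_iff[OF \<open>0 < N\<close>]
    using controllable_iff_bounded[OF A b D le_last_delay N_def] by blast
  ultimately show ?thesis unfolding halts_with_answer_def by (intro exI[of _ s] conjI) simp_all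
qed

theorem corollary4:
  "\<exists>P. \<forall>(n::nat) (A::real mat) (b::real vec) (D::nat set).
     A \<in> carrier_mat n n \<longrightarrow> b \<in> carrier_vec n \<longrightarrow> finite D \<longrightarrow>
       halts_with_answer P (input_state n A b D) (controllable A b D)"
  using Decide_correct by blast

end
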